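(* Let $n\geq 2$ and let $\Omega$ be a bounded domain in $\mathbb{R}^n$ with $C^{4+\epsilon}$ boundary. Let $g:\mathbb{R}\to\mathbb{R}$ be a $C^2$ function and set $G(t)=\int_0^t g(s)\,ds$. Let $c$ be a constant and suppose $u\in C^4(\overline{\Omega})$ solves $$\Delta^2 u=-g(u) \ \text{in } \Omega,\qquad u=\frac{\partial u}{\partial\nu}=0 \ \text{on } \partial\Omega,\qquad \Delta u=c \ \text{on } \partial\Omega.$$ Then $$\int_{\Omega}\Big(2(n+2)\big(3G(u)+c^2\big)+\big(3n\Delta u-(n-4)c\big)(\Delta u-c)\Big)g(u)\,dx = 4(n+2)\int_{\Omega}(\Delta u-c)\Big\{|\nabla^3 u|^2-\frac{3}{n+2}|\nabla(\Delta u)|^2\Big\}dx +(n+2)\int_{\Omega}|\nabla u|^2\,\Delta(g(u))\,dx.$$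
   Context: $\nu$ is the outward unit normal of $\partial\Omega$. $\nabla^3u=\nabla(\nabla^2u)$ is the derivative of the Hessian of $u$, so that $|\nabla^3u|^2=\sum_{i,j,k}\big(\frac{\partial^3 u}{\partial x_i\partial x_j\partial x_k}\big)^2$. *)

theory Defs
  imports "HOL-Analysis.Analysis"
begin

definition pd :: "'n::finite \<Rightarrow> (real^'n \<Rightarrow> real) \<Rightarrow> real^'n \<Rightarrow> real" where
  "pd i f x = deriv (\<lambda>t. f (x + t *\<^sub>R axis i 1)) 0"

primrec dpart :: "'n::finite list \<Rightarrow> (real^'n \<Rightarrow> real) \<Rightarrow> real^'n \<Rightarrow> real" where
  "dpart [] f = f"
| "dpart (i # is) f = pd i (dpart is f)"

definition grad :: "(real^'n::finite \<Rightarrow> real) \<Rightarrow> real^'n \<Rightarrow> real^'n" where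
  "grad f x = (\<chi> i. pd i f x)"

definition lap :: "(real^'n::finite \<Rightarrow> real) \<Rightarrow> real^'n \<Rightarrow> real" where
  "lap f x = (\<Sum>i\<in>UNIV. pd i (pd i f) x)"

definition hess3_sq :: "(real^'n::finite \<Rightarrow> real) \<Rightarrow> real^'n \<Rightarrow> real" where
  "hess3_sq f x = (\<Sum>i\<in>UNIV. \<Sum>j\<in>UNIV. \<Sum>k\<in>UNIV. (dpart [i, j, k] f x)\<^sup>2)"

definition Ck_on :: "nat \<Rightarrow> (real^'n::finite \<Rightarrow> real) \<Rightarrow> (real^'n) set \<Rightarrow> bool" where
  "Ck_on k f S \<longleftrightarrow>
     (\<forall>js i x. length js < k \<and> x \<in> S \<longrightarrow>
        (\<lambda>t. dpart js f (x + t *\<^sub>R axis i 1)) differentiable (at 0)) \<and>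
     (\<forall>js. length js \<le> k \<longrightarrow> continuous_on S (dpart js f))"

definition Ck_closure :: "nat \<Rightarrow> (real^'n::finite \<Rightarrow> real) \<Rightarrow> (real^'n) set \<Rightarrow> bool" where
  "Ck_closure k f S \<longleftrightarrow> Ck_on k f S \<and>
     (\<forall>js. length js \<le> k \<longrightarrow>
        (\<exists>h. continuous_on (closure S) h \<and> (\<forall>x\<in>S. h x = dpart js f x)))"

definition bval :: "(real^'n::finite) set \<Rightarrow> (real^'n \<Rightarrow> 'b::t2_space) \<Rightarrow> real^'n \<Rightarrow> 'b" where
  "bval S f p = Lim (at p within S) f"

definition bounded_domain :: "(real^'n::finite) set \<Rightarrow> bool" where
  "bounded_domain S \<longleftrightarrow> open S \<and> connected S \<and> bounded S \<and> S \<noteq> {}"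

definition Ck_alpha_boundary :: "nat \<Rightarrow> real \<Rightarrow> (real^'n::finite) set \<Rightarrow> bool" where
  "Ck_alpha_boundary k \<alpha> S \<longleftrightarrow>
     (\<forall>p\<in>frontier S. \<exists>r \<phi>. r > 0 \<and> Ck_on k \<phi> (ball p r) \<and>
        (\<exists>K. \<forall>js x y. length js = k \<and> x \<in> ball p r \<and> y \<in> ball p r \<longrightarrow>
             \<bar>dpart js \<phi> x - dpart js \<phi> y\<bar> \<le> K * dist x y powr \<alpha>) \<and>
        (\<forall>x\<in>ball p r. grad \<phi> x \<noteq> 0) \<and>
        S \<inter> ball p r = {x \<in> ball p r. \<phi> x < 0})"

definition outward_normal :: "(real^'n::finite) set \<Rightarrow> real^'n \<Rightarrow> real^'n" where
  "outward_normal S p = (SOME \<nu>. \<exists>r \<phi>. r > 0 \<and> Ck_on 1 \<phi> (ball p r) \<and>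
        (\<forall>x\<in>ball p r. grad \<phi> x \<noteq> 0) \<and>
        S \<inter> ball p r = {x \<in> ball p r. \<phi> x < 0} \<and>
        \<nu> = (1 / norm (grad \<phi> p)) *\<^sub>R grad \<phi> p)"

definition prim0 :: "(real \<Rightarrow> real) \<Rightarrow> real \<Rightarrow> real" where
  "prim0 g t = (if 0 \<le> t then integral {0..t} g else - integral {t..0} g)"

definition C2_real :: "(real \<Rightarrow> real) \<Rightarrow> bool" where
  "C2_real g \<longleftrightarrow> g differentiable_on UNIV \<and> deriv g differentiable_on UNIV \<and>
     continuous_on UNIV (deriv (deriv g))"

end

(* On the boundary u = 0 and du/dnu = 0 force grad u = 0, hence D^2 u = c nu nu^T, so that
   |D^2 u|^2 = c^2 there. With w = Delta u (so Delta w = -g(u)), the identity is a linear combination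
   of the integrals of the divergences of
     (w - c) grad|D^2 u|^2 / 2,  (|D^2 u|^2 - c^2) grad w,  (w - c) D^2 u grad w,  (w - c)^2 grad w,
     (grad u . grad w) grad w,  |grad w|^2 grad u,  G(u) grad w,  (w - c) grad w,
     |grad u|^2 grad(g(u)),  g(u) D^2 u grad u.
   Each of these fields vanishes componentwise on the boundary, so the divergence theorem is only
   needed in the form: the integral of d_i f is 0 if f vanishes on the boundary. That form holds on any
   bounded open set and follows from translation invariance of Lebesgue measure applied to the
   difference quotients of the zero extension of f. *)

theory Submission
  imports Defs
begin

text \<open>Boundary values exist only as limits from inside: \<open>Ck_closure\<close> gives
  continuous extensions of the derivatives, but no differentiable extension past the boundary, so u
  = 0 cannot simply be differentiated along a chart. Tangential derivatives at a boundary point are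
  instead read off from increments of the zero extension along nearly tangential rays. This is
  applied twice: to u, where the Neumann condition then removes the remaining normal component of
  the gradient, and to each component of grad u, which now vanishes on the boundary too. The latter
  makes every column of the limiting Hessian a multiple of nu; symmetry turns this into beta nu
  nu^T, and the trace identifies beta with c. The linear combination starts from the Laplacian of
  |D^2 u|^2 / 2, the only source of |nabla^3 u|^2; most of the other fields serve to remove terms
  that are left over. The fields contain derivatives of u up to order three and their divergences up
  to order four, all of them continuous up to the boundary for u in C^4.\<close>

section \<open>Partial derivatives\<close>

text \<open>The derivative is an explicit argument, so that derivatives of sums and products are
  computed by rules instead of by evaluating \<open>deriv\<close>. Differentiability along
  coordinate lines is the form that \<open>Ck_on\<close> provides.\<close>

definition hpart :: "(real^'n::finite) set \<Rightarrow> 'n \<Rightarrow> (real^'n \<Rightarrow> real) \<Rightarrow> (real^'n \<Rightarrow> real) \<Rightarrow> bool"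
  where "hpart S i f f' \<longleftrightarrow>
    (\<forall>x\<in>S. ((\<lambda>t. f (x + t *\<^sub>R axis i 1)) has_real_derivative f' x) (at 0))"

lemma hpart_pd: "hpart S i f f' \<Longrightarrow> x \<in> S \<Longrightarrow> pd i f x = f' x"
  unfolding hpart_def pd_def by (auto intro: DERIV_imp_deriv)

lemma hpart_const: "hpart S i (\<lambda>x. a) (\<lambda>x. 0)"
  by (simp add: hpart_def)

lemma hpart_diff:
  "hpart S i f f' \<Longrightarrow> hpart S i k k' \<Longrightarrow> hpart S i (\<lambda>x. f x - k x) (\<lambda>x. f' x - k' x)"
  by (auto simp: hpart_def intro!: derivative_eq_intros)

lemma hpart_mult:
  "hpart S i f f' \<Longrightarrow> hpart S i k k' \<Longrightarrow>
    hpart S i (\<lambda>x. f x * k x) (\<lambda>x. f' x * k x + f x * k' x)"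
  by (auto simp: hpart_def intro!: derivative_eq_intros)

lemma hpart_power2:
  "hpart S i f f' \<Longrightarrow> hpart S i (\<lambda>x. (f x)\<^sup>2) (\<lambda>x. 2 * (f x * f' x))"
  using hpart_mult[of S i f f' f f'] by (simp add: power2_eq_square algebra_simps)

lemma hpart_sum:
  "(\<And>j. hpart S i (f j) (f' j)) \<Longrightarrow> hpart S i (\<lambda>x. \<Sum>j\<in>A. f j x) (\<lambda>x. \<Sum>j\<in>A. f' j x)"
  by (auto simp: hpart_def intro!: derivative_eq_intros)

lemma hpart_compose:
  assumes "hpart S i f f'" and "\<And>t. (k has_real_derivative k' t) (at t)"
  shows "hpart S i (\<lambda>x. k (f x)) (\<lambda>x. k' (f x) * f' x)"
  unfolding hpart_def
proof
  fix x assume x: "x \<in> S"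
  have "((\<lambda>t. f (x + t *\<^sub>R axis i 1)) has_real_derivative f' x) (at 0)"
    using assms(1) x by (simp add: hpart_def)
  from DERIV_chain2[OF _ this, of k "k' (f x)"] assms(2)
  show "((\<lambda>t. k (f (x + t *\<^sub>R axis i 1))) has_real_derivative k' (f x) * f' x) (at 0)"
    by simp
qed

lemma eventually_line_in_open:
  fixes S :: "(real^'n::finite) set"
  assumes "open S" "x \<in> S"
  shows "\<forall>\<^sub>F t in nhds 0. x + t *\<^sub>R d \<in> S"
proof -
  have "isCont (\<lambda>t. x + t *\<^sub>R d) 0" by (intro continuous_intros)
  then have "((\<lambda>t. x + t *\<^sub>R d) \<longlongrightarrow> x) (nhds 0)"
    using tendsto_at_iff_tendsto_nhds[of "\<lambda>t. x + t *\<^sub>R d" 0] by (simp add: isCont_def)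
  then show ?thesis using assms by (auto simp: tendsto_def)
qed

lemma hpart_cong:
  assumes "open S" and "\<And>x. x \<in> S \<Longrightarrow> f x = k x" and "\<And>x. x \<in> S \<Longrightarrow> f' x = k' x"
    and "hpart S i f f'"
  shows "hpart S i k k'"
  unfolding hpart_def
proof
  fix x assume x: "x \<in> S"
  have "\<forall>\<^sub>F t in nhds 0. f (x + t *\<^sub>R axis i 1) = k (x + t *\<^sub>R axis i 1)"
    using eventually_line_in_open[OF assms(1) x, of "axis i 1"] by eventually_elim (rule assms(2))
  moreover have "((\<lambda>t. f (x + t *\<^sub>R axis i 1)) has_real_derivative k' x) (at 0)"
    using assms x by (simp add: hpart_def)
  ultimately show "((\<lambda>t. k (x + t *\<^sub>R axis i 1)) has_real_derivative k' x) (at 0)"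
    using DERIV_cong_ev[OF refl _ refl] by iprover
qed

text \<open>The base point is moved: a derivative known at parameter 0 for every base point in S is
  read at parameter s on one fixed line, as the mean value theorem requires. The direction is
  arbitrary because boundary gradients are later tested along oblique rays.\<close>

lemma line_derivative_at:
  fixes f :: "'a::real_vector \<Rightarrow> real"
  assumes "\<And>y. y \<in> S \<Longrightarrow> ((\<lambda>t. f (y + t *\<^sub>R d)) has_real_derivative D y) (at 0)"
    and "x + s *\<^sub>R d \<in> S"
  shows "((\<lambda>t. f (x + t *\<^sub>R d)) has_real_derivative D (x + s *\<^sub>R d)) (at s)"
proof -
  have "((\<lambda>t. f (x + (s + t) *\<^sub>R d)) has_real_derivative D (x + s *\<^sub>R d)) (at 0)"
    using assms(1)[OF assms(2)] by (simp add: scaleR_add_left add.assoc)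
  then show ?thesis
    using DERIV_shift[of "\<lambda>t. f (x + t *\<^sub>R d)" _ 0 s] by (simp add: add.commute)
qed

lemma hpart_line:
  assumes "hpart S i f f'" "x + s *\<^sub>R axis i 1 \<in> S"
  shows "((\<lambda>t. f (x + t *\<^sub>R axis i 1)) has_real_derivative f' (x + s *\<^sub>R axis i 1)) (at s)"
  using assms line_derivative_at[of S f "axis i 1" f'] by (simp add: hpart_def)

lemma hpart_mvt:
  assumes "hpart S i f f'" "\<And>s. \<bar>s\<bar> \<le> \<bar>h\<bar> \<Longrightarrow> x + s *\<^sub>R axis i 1 \<in> S"
  shows "\<exists>s. \<bar>s\<bar> \<le> \<bar>h\<bar> \<and> f (x + h *\<^sub>R axis i 1) - f x = h * f' (x + s *\<^sub>R axis i 1)"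
proof -
  consider "h = 0" | "h > 0" | "h < 0" by linarith
  then show ?thesis
  proof cases
    case 1 then show ?thesis by (auto intro!: exI[of _ 0])
  next
    case 2
    have "\<exists>z. 0 < z \<and> z < h \<and> f (x + h *\<^sub>R axis i 1) - f (x + 0 *\<^sub>R axis i 1) = (h - 0) * f' (x + z *\<^sub>R axis i 1)"
      by (rule MVT2[OF 2]) (rule hpart_line[OF assms(1)], rule assms(2), auto)
    then obtain z where "0 < z" "z < h" "f (x + h *\<^sub>R axis i 1) - f x = h * f' (x + z *\<^sub>R axis i 1)"
      by auto
    then show ?thesis by (auto intro!: exI[of _ z])
  next
    case 3
    have "\<exists>z. h < z \<and> z < 0 \<and> f (x + 0 *\<^sub>R axis i 1) - f (x + h *\<^sub>R axis i 1) = (0 - h) * f' (x + z *\<^sub>R axis i 1)"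
      by (rule MVT2[OF 3]) (rule hpart_line[OF assms(1)], rule assms(2), auto)
    then obtain z where "h < z" "z < 0" "f x - f (x + h *\<^sub>R axis i 1) = (0 - h) * f' (x + z *\<^sub>R axis i 1)"
      by auto
    then show ?thesis by (auto intro!: exI[of _ z])
  qed
qed

text \<open>Walk from x to y changing one coordinate at a time: each leg is a mean value increment
  of one partial derivative, and continuity compares its value with the one at x.\<close>

lemma hpart_has_derivative:
  fixes f :: "real^'n \<Rightarrow> real"
  assumes "open S" "x \<in> S" and hp: "\<And>i. hpart S i f (f' i)" and co: "\<And>i. continuous_on S (f' i)"
  shows "(f has_derivative (\<lambda>h. \<Sum>i\<in>UNIV. h $ i * f' i x)) (at x)"
  unfolding has_derivative_at_alt
proof (intro conjI allI impI)
  show "bounded_linear (\<lambda>h. \<Sum>i\<in>UNIV. h $ i * f' i x)"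
    by (intro bounded_linear_sum bounded_linear_mult_left[THEN bounded_linear_compose]
        bounded_linear_vec_nth)
next
  fix e :: real assume "e > 0"
  \<comment> \<open>There are \<open>CARD('n)\<close> legs, each contributing an error of at most e'
    * norm h.\<close>
  define e' where "e' = e / real CARD('n)"
  have e': "e' > 0" using \<open>e > 0\<close> by (simp add: e'_def)
  have "\<forall>\<^sub>F y in nhds x. y \<in> S \<and> (\<forall>i. \<bar>f' i y - f' i x\<bar> < e')"
  proof (intro eventually_conj eventually_all_finite)
    show "\<forall>\<^sub>F y in nhds x. y \<in> S" using assms(1,2) by (rule eventually_nhds_in_open)
    fix i
    have "(f' i \<longlongrightarrow> f' i x) (nhds x)"
      using co[of i] assms(1,2) by (metis continuous_on_eq_continuous_at isCont_def tendsto_at_iff_tendsto_nhds)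
    then show "\<forall>\<^sub>F y in nhds x. \<bar>f' i y - f' i x\<bar> < e'"
      using e' by (auto simp: tendsto_iff dist_real_def)
  qed
  then obtain d where d: "d > 0" "\<And>y. dist y x < d \<Longrightarrow> y \<in> S \<and> (\<forall>i. \<bar>f' i y - f' i x\<bar> < e')"
    by (auto simp: eventually_nhds_metric)
  show "\<exists>d>0. \<forall>y. norm (y - x) < d \<longrightarrow>
          norm (f y - f x - (\<Sum>i\<in>UNIV. (y - x) $ i * f' i x)) \<le> e * norm (y - x)"
  proof (intro exI conjI allI impI, rule d(1))
    fix y assume y: "norm (y - x) < d"
    define h where "h = y - x"
    \<comment> \<open>Displacement with only the coordinates in A switched on; enlarging A index by
      index walks from x to y.\<close>
    define cut where "cut A = (\<chi> i. if i \<in> A then h $ i else 0)" for A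
    have "\<bar>f (x + cut A) - f x - (\<Sum>i\<in>A. h $ i * f' i x)\<bar> \<le> e' * (\<Sum>i\<in>A. \<bar>h $ i\<bar>)" for A
    proof (induction A rule: finite_induct[OF finite])
      case 1
      have "cut {} = 0" by (simp add: cut_def vec_eq_iff)
      then show ?case by simp
    next
      case (2 j A)
      have ins: "cut (insert j A) = cut A + (h $ j) *\<^sub>R axis j 1"
        using 2 by (auto simp: cut_def vec_eq_iff axis_def)
      \<comment> \<open>Componentwise no larger than h, so the whole leg stays in the ball of radius
        d about x.\<close>
      have near: "dist (x + cut A + s *\<^sub>R axis j 1) x < d" if "\<bar>s\<bar> \<le> \<bar>h $ j\<bar>" for s
      proof -
        have "norm (cut A + s *\<^sub>R axis j 1) \<le> norm h"
          by (rule norm_le_componentwise_cart) (use 2 that in \<open>auto simp: cut_def axis_def\<close>)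
        then show ?thesis using y by (simp add: dist_norm h_def add.assoc)
      qed
      obtain s where s: "\<bar>s\<bar> \<le> \<bar>h $ j\<bar>"
        "f (x + cut A + (h $ j) *\<^sub>R axis j 1) - f (x + cut A) = h $ j * f' j (x + cut A + s *\<^sub>R axis j 1)"
        using hpart_mvt[OF hp[of j], of "h $ j" "x + cut A"] near d(2) by blast
      have "\<bar>f' j (x + cut A + s *\<^sub>R axis j 1) - f' j x\<bar> \<le> e'"
        using d(2) near[OF s(1)] by (simp add: less_imp_le)
      from mult_left_mono[OF this abs_ge_zero[of "h $ j"]]
      have "\<bar>h $ j * (f' j (x + cut A + s *\<^sub>R axis j 1) - f' j x)\<bar> \<le> e' * \<bar>h $ j\<bar>"
        by (simp only: abs_mult mult.commute)
      moreover have "f (x + cut (insert j A)) - f x - (\<Sum>i\<in>insert j A. h $ i * f' i x)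
        = (f (x + cut A) - f x - (\<Sum>i\<in>A. h $ i * f' i x))
          + h $ j * (f' j (x + cut A + s *\<^sub>R axis j 1) - f' j x)"
        using 2 s(2) by (simp add: ins add.assoc algebra_simps)
      ultimately show ?case using 2 by (simp add: distrib_left)
    qed
    moreover have "cut UNIV = h" by (simp add: cut_def vec_eq_iff)
    ultimately have "\<bar>f y - f x - (\<Sum>i\<in>UNIV. h $ i * f' i x)\<bar> \<le> e' * (\<Sum>i\<in>UNIV. \<bar>h $ i\<bar>)"
      by (metis add_diff_cancel_left' add.commute diff_add_cancel h_def)
    also have "\<dots> \<le> e' * (real CARD('n) * norm h)"
      using e' sum_bounded_above[of UNIV "\<lambda>i. \<bar>h $ i\<bar>" "norm h"]
      by (intro mult_left_mono) (auto simp: component_le_norm_cart)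
    finally show "norm (f y - f x - (\<Sum>i\<in>UNIV. (y - x) $ i * f' i x)) \<le> e * norm (y - x)"
      by (simp add: h_def e'_def)
  qed
qed

section \<open>Symmetry of second partial derivatives\<close>

lemma second_difference_mvt:
  assumes hi: "hpart S i f fi" and hji: "hpart S j fi fji" and sub: "ball x (2 * s) \<subseteq> S" and "s > 0"
    and t: "0 < t" "t < s"
  shows "\<exists>\<xi>. dist \<xi> x \<le> 2 * t \<and>
    f (x + t *\<^sub>R axis i 1 + t *\<^sub>R axis j 1) - f (x + t *\<^sub>R axis i 1) - f (x + t *\<^sub>R axis j 1) + f x
      = t\<^sup>2 * fji \<xi>"
proof -
  have near: "dist (x + a *\<^sub>R axis i 1 + b *\<^sub>R axis j 1) x \<le> 2 * t" if "\<bar>a\<bar> \<le> t" "\<bar>b\<bar> \<le> t" for a b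
  proof -
    have "norm (a *\<^sub>R axis i 1 + b *\<^sub>R axis j (1::real)) \<le> \<bar>a\<bar> + \<bar>b\<bar>"
      by (rule norm_triangle_le) simp
    then show ?thesis using that by (simp add: dist_norm add.assoc)
  qed
  have inS: "x + a *\<^sub>R axis i 1 + b *\<^sub>R axis j 1 \<in> S" if "\<bar>a\<bar> \<le> t" "\<bar>b\<bar> \<le> t" for a b
    using near[OF that] sub t by (auto simp: subset_iff dist_commute)
  \<comment> \<open>The first difference in direction j is treated as a function to be
    differentiated in direction i; T is where both of its points lie in S.\<close>
  define T where "T = {y. y \<in> S \<and> y + t *\<^sub>R axis j 1 \<in> S}"
  have "hpart T i (\<lambda>y. f (y + t *\<^sub>R axis j 1) - f y) (\<lambda>y. fi (y + t *\<^sub>R axis j 1) - fi y)"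
    using hi unfolding hpart_def T_def
    by (auto intro!: derivative_eq_intros simp: ac_simps)
  from hpart_mvt[OF this, of t x] inS[of _ t] inS[of _ 0] t
  obtain a where a: "\<bar>a\<bar> \<le> t" "f (x + t *\<^sub>R axis i 1 + t *\<^sub>R axis j 1) - f (x + t *\<^sub>R axis i 1) - (f (x + t *\<^sub>R axis j 1) - f x)
     = t * (fi (x + a *\<^sub>R axis i 1 + t *\<^sub>R axis j 1) - fi (x + a *\<^sub>R axis i 1))"
    by (auto simp: T_def)
  obtain b where b: "\<bar>b\<bar> \<le> t" "fi (x + a *\<^sub>R axis i 1 + t *\<^sub>R axis j 1) - fi (x + a *\<^sub>R axis i 1)
     = t * fji (x + a *\<^sub>R axis i 1 + b *\<^sub>R axis j 1)"
    using hpart_mvt[OF hji, of t "x + a *\<^sub>R axis i 1"] inS[OF a(1)] t by auto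
  show ?thesis
    by (rule exI[of _ "x + a *\<^sub>R axis i 1 + b *\<^sub>R axis j 1"])
      (use a b near in \<open>auto simp: power2_eq_square\<close>)
qed

text \<open>The second difference over a small square does not depend on the order of i and j, and
  each order represents it by one of the mixed derivatives at a nearby point. Equal values near x
  contradict different values at x.\<close>

lemma schwarz_symmetry:
  assumes "open S" "x \<in> S" and hi: "hpart S i f fi" and hj: "hpart S j f fj"
    and hji: "hpart S j fi fji" and hij: "hpart S i fj fij"
    and cji: "continuous_on S fji" and cij: "continuous_on S fij"
  shows "fji x = fij x"
proof (rule ccontr)
  assume ne: "fji x \<noteq> fij x"
  \<comment> \<open>Half the gap: two equal numbers cannot lie within e of \<open>fji x\<close> and
    of \<open>fij x\<close>.\<close>
  define e where "e = \<bar>fji x - fij x\<bar> / 2"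
  have e: "e > 0" using ne by (simp add: e_def)
  have "\<forall>\<^sub>F y in nhds x. y \<in> S \<and> \<bar>fji y - fji x\<bar> < e \<and> \<bar>fij y - fij x\<bar> < e"
  proof (intro eventually_conj)
    show "\<forall>\<^sub>F y in nhds x. y \<in> S" using assms(1,2) by (rule eventually_nhds_in_open)
    have "(fji \<longlongrightarrow> fji x) (nhds x)" "(fij \<longlongrightarrow> fij x) (nhds x)"
      using cji cij assms(1,2)
      by (metis continuous_on_eq_continuous_at isCont_def tendsto_at_iff_tendsto_nhds)+
    then show "\<forall>\<^sub>F y in nhds x. \<bar>fji y - fji x\<bar> < e" "\<forall>\<^sub>F y in nhds x. \<bar>fij y - fij x\<bar> < e"
      using e by (auto simp: tendsto_iff dist_real_def)
  qed
  then obtain d where d: "d > 0"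
    "\<And>y. dist y x < d \<Longrightarrow> y \<in> S \<and> \<bar>fji y - fji x\<bar> < e \<and> \<bar>fij y - fij x\<bar> < e"
    by (auto simp: eventually_nhds_metric)
  \<comment> \<open>The ball of radius d in the form that the second difference expects. Squares of
    side d/4 then have their intermediate points within d/2 of x.\<close>
  have sub: "ball x (2 * (d / 2)) \<subseteq> S" using d by (auto simp: dist_commute)
  obtain \<xi> where \<xi>: "dist \<xi> x \<le> 2 * (d / 4)"
    "f (x + (d/4) *\<^sub>R axis i 1 + (d/4) *\<^sub>R axis j 1) - f (x + (d/4) *\<^sub>R axis i 1) - f (x + (d/4) *\<^sub>R axis j 1) + f x = (d/4)\<^sup>2 * fji \<xi>"
    using second_difference_mvt[OF hi hji sub, of "d / 4"] d(1) by auto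
  obtain \<eta> where \<eta>: "dist \<eta> x \<le> 2 * (d / 4)"
    "f (x + (d/4) *\<^sub>R axis j 1 + (d/4) *\<^sub>R axis i 1) - f (x + (d/4) *\<^sub>R axis j 1) - f (x + (d/4) *\<^sub>R axis i 1) + f x = (d/4)\<^sup>2 * fij \<eta>"
    using second_difference_mvt[OF hj hij sub, of "d / 4"] d(1) by auto
  have swap: "x + (d/4) *\<^sub>R axis j 1 + (d/4) *\<^sub>R axis i 1 = x + (d/4) *\<^sub>R axis i 1 + (d/4) *\<^sub>R axis j 1"
    by (simp only: ac_simps)
  have "(d/4)\<^sup>2 * fji \<xi> = (d/4)\<^sup>2 * fij \<eta>"
    unfolding \<xi>(2)[symmetric] \<eta>(2)[symmetric] swap by simp
  then have "fji \<xi> = fij \<eta>" using d(1) by simp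
  moreover have "\<bar>fji \<xi> - fji x\<bar> < e" "\<bar>fij \<eta> - fij x\<bar> < e"
    using d \<xi>(1) \<eta>(1) by auto
  ultimately show False unfolding e_def by (simp add: abs_if split: if_splits)
qed

section \<open>Functions with a continuous extension to the closure\<close>

text \<open>The extension clause of \<open>Ck_closure\<close> for a single function. For bounded
  open S it yields bounds, integrability and limits at all frontier points.\<close>

definition ext_cont :: "(real^'n::finite) set \<Rightarrow> (real^'n \<Rightarrow> real) \<Rightarrow> bool"
  where "ext_cont S f \<longleftrightarrow> (\<exists>h. continuous_on (closure S) h \<and> (\<forall>x\<in>S. h x = f x))"

definition vanishing :: "(real^'n::finite) set \<Rightarrow> (real^'n \<Rightarrow> real) \<Rightarrow> bool"
  where "vanishing S f \<longleftrightarrow> (\<forall>p\<in>frontier S. (f \<longlongrightarrow> 0) (at p within S))"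

lemma ext_cont_const: "ext_cont S (\<lambda>x. a)"
  unfolding ext_cont_def by (auto intro!: exI[of _ "\<lambda>x. a"])

lemma ext_cont_add: "ext_cont S f \<Longrightarrow> ext_cont S k \<Longrightarrow> ext_cont S (\<lambda>x. f x + k x)"
  unfolding ext_cont_def by (metis (no_types, lifting) continuous_on_add)

lemma ext_cont_mult: "ext_cont S f \<Longrightarrow> ext_cont S k \<Longrightarrow> ext_cont S (\<lambda>x. f x * k x)"
  unfolding ext_cont_def by (metis (no_types, lifting) continuous_on_mult)

lemma ext_cont_diff: "ext_cont S f \<Longrightarrow> ext_cont S k \<Longrightarrow> ext_cont S (\<lambda>x. f x - k x)"
  unfolding ext_cont_def by (metis (no_types, lifting) continuous_on_diff)

lemma ext_cont_power: "ext_cont S f \<Longrightarrow> ext_cont S (\<lambda>x. f x ^ m)"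
  unfolding ext_cont_def by (metis (no_types, lifting) continuous_on_power)

lemma ext_cont_sum: "(\<And>j. ext_cont S (f j)) \<Longrightarrow> ext_cont S (\<lambda>x. \<Sum>j\<in>A. f j x)"
  by (induction A rule: infinite_finite_induct) (auto intro: ext_cont_const ext_cont_add)

lemma ext_cont_compose:
  assumes "ext_cont S f" "continuous_on UNIV k"
  shows "ext_cont S (\<lambda>x. k (f x))"
proof -
  obtain h where "continuous_on (closure S) h" "\<forall>x\<in>S. h x = f x"
    using assms(1) by (auto simp: ext_cont_def)
  then show ?thesis unfolding ext_cont_def
    using continuous_on_compose2[OF assms(2)] by (intro exI[of _ "\<lambda>x. k (h x)"]) auto
qed

lemmas ext_cont_intros = ext_cont_const ext_cont_add ext_cont_mult ext_cont_diff ext_cont_power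
  ext_cont_sum

lemma ext_cont_imp_continuous_on: "ext_cont S f \<Longrightarrow> continuous_on S f"
  unfolding ext_cont_def by (metis closure_subset continuous_on_cong continuous_on_subset)

lemma ext_cont_bounded:
  assumes "bounded S" "ext_cont S f"
  obtains M where "M \<ge> 0" "\<And>x. x \<in> S \<Longrightarrow> \<bar>f x\<bar> \<le> M"
proof -
  obtain h where h: "continuous_on (closure S) h" "\<forall>x\<in>S. h x = f x"
    using assms(2) by (auto simp: ext_cont_def)
  then have "bounded (h ` closure S)"
    using assms(1) compact_closure compact_continuous_image compact_imp_bounded by blast
  then obtain M where "M > 0" "\<forall>y\<in>h ` closure S. norm y \<le> M"
    by (auto simp: bounded_pos)
  then show thesis using h closure_subset[of S] that[of M] by (force simp: subset_iff)
qed

lemma ext_cont_tendsto: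
  assumes "continuous_on (closure S) h" "\<forall>x\<in>S. h x = f x" "p \<in> closure S"
  shows "(f \<longlongrightarrow> h p) (at p within S)"
proof -
  have "(h \<longlongrightarrow> h p) (at p within S)"
    using assms(1,3) closure_subset by (metis continuous_on_def tendsto_within_subset)
  moreover have "\<forall>\<^sub>F x in at p within S. h x = f x"
    using assms(2) by (auto simp: eventually_at_filter)
  ultimately show ?thesis by (rule Lim_transform_eventually)
qed

lemma ext_cont_tendsto_ex:
  assumes "ext_cont S f" "p \<in> frontier S"
  obtains l where "(f \<longlongrightarrow> l) (at p within S)"
proof -
  obtain h where "continuous_on (closure S) h" "\<forall>x\<in>S. h x = f x"
    using assms(1) by (auto simp: ext_cont_def)
  from ext_cont_tendsto[OF this, of p] assms(2) that show thesis
    by (auto simp: frontier_def)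
qed

lemma vanishing_mult:
  assumes "vanishing S f" "ext_cont S k"
  shows "vanishing S (\<lambda>x. f x * k x)"
  unfolding vanishing_def
proof
  fix p assume p: "p \<in> frontier S"
  obtain l where "(k \<longlongrightarrow> l) (at p within S)" using ext_cont_tendsto_ex[OF assms(2) p] .
  with assms(1) p have "((\<lambda>x. f x * k x) \<longlongrightarrow> 0 * l) (at p within S)"
    unfolding vanishing_def by (intro tendsto_mult) auto
  then show "((\<lambda>x. f x * k x) \<longlongrightarrow> 0) (at p within S)" by simp
qed

lemma vanishing_sum:
  "(\<And>j. vanishing S (f j)) \<Longrightarrow> vanishing S (\<lambda>x. \<Sum>j\<in>A. f j x)"
  unfolding vanishing_def by (auto intro: tendsto_null_sum)

text \<open>At a frontier point the limit from S is 0 by assumption and the limit from the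
  complement is 0 by construction.\<close>

lemma continuous_zero_extension:
  fixes f :: "real^'n \<Rightarrow> real"
  assumes "open S" "continuous_on S f" "vanishing S f"
  shows "continuous_on UNIV (\<lambda>x. if x \<in> S then f x else 0)"
proof -
  let ?F = "\<lambda>x. if x \<in> S then f x else 0"
  have "isCont ?F p" for p
  proof -
    consider "p \<in> S" | "p \<in> frontier S" "p \<notin> S" | "p \<in> - closure S"
      using assms(1) by (auto simp: frontier_def interior_open)
    then show ?thesis
    proof cases
      case 1
      have "\<forall>\<^sub>F x in nhds p. x \<in> S" using assms(1) 1 by (rule eventually_nhds_in_open)
      then have "\<forall>\<^sub>F x in nhds p. ?F x = f x" by eventually_elim simp
      moreover have "isCont f p" using assms(1,2) 1 by (simp add: continuous_on_eq_continuous_at)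
      ultimately show ?thesis using isCont_cong[of ?F f p] by simp
    next
      case 2
      have "(?F \<longlongrightarrow> 0) (at p within S)"
        by (rule Lim_transform_eventually[of f])
          (use assms(3) 2 in \<open>auto simp: vanishing_def eventually_at_filter\<close>)
      moreover have "(?F \<longlongrightarrow> 0) (at p within - S)"
        by (rule Lim_transform_eventually[of "\<lambda>x. 0"]) (auto simp: eventually_at_filter)
      ultimately have "(?F \<longlongrightarrow> 0) (at p within S \<union> - S)" by (rule Lim_Un)
      then show ?thesis using 2 by (simp add: isCont_def)
    next
      case 3
      have "\<forall>\<^sub>F x in nhds p. x \<in> - closure S" using 3 by (intro eventually_nhds_in_open) auto
      then have "\<forall>\<^sub>F x in nhds p. ?F x = 0"
        by eventually_elim (use closure_subset in auto)
      then show ?thesis using isCont_cong[of ?F "\<lambda>x. 0"] by simp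
    qed
  qed
  then show ?thesis by (simp add: continuous_at_imp_continuous_on)
qed

section \<open>Increments of a zero extension along a line\<close>

lemma segment_mvt:
  fixes f :: "'a::real_normed_vector \<Rightarrow> real"
  assumes F: "continuous_on UNIV F" "\<And>y. y \<in> S \<Longrightarrow> F y = f y" and "open S"
    and D: "\<And>y. y \<in> S \<Longrightarrow> ((\<lambda>t. f (y + t *\<^sub>R d)) has_real_derivative D y) (at 0)"
    and h: "0 < h"
    and seg: "\<And>t. 0 < t \<Longrightarrow> t < h \<Longrightarrow> x + t *\<^sub>R d \<in> S"
  obtains z where "0 < z" "z < h" "F (x + h *\<^sub>R d) - F x = h * D (x + z *\<^sub>R d)"
proof -
  \<comment> \<open>Only the open segment lies in S, and its ends may be on the frontier: continuity
    at the ends comes from F, the derivative inside from f.\<close>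
  have cont: "continuous_on {0..h} (\<lambda>t. F (x + t *\<^sub>R d))"
    by (intro continuous_on_compose2[OF F(1)] continuous_intros) auto
  have der: "((\<lambda>t. F (x + t *\<^sub>R d)) has_derivative (\<lambda>s. s * D (x + t *\<^sub>R d))) (at t)"
    if t: "0 < t" "t < h" for t
  proof -
    have "\<forall>\<^sub>F s in nhds t. x + s *\<^sub>R d \<in> S"
    proof -
      have "\<forall>\<^sub>F s in nhds t. s \<in> {0<..<h}" using t by (intro eventually_nhds_in_open) auto
      then show ?thesis by eventually_elim (use seg in auto)
    qed
    then have ev: "\<forall>\<^sub>F s in nhds t. f (x + s *\<^sub>R d) = F (x + s *\<^sub>R d)"
      by eventually_elim (simp add: F(2))
    have "((\<lambda>t. f (x + t *\<^sub>R d)) has_real_derivative D (x + t *\<^sub>R d)) (at t)"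
      using line_derivative_at[of S f d D, OF D] seg[OF t] by blast
    then have "((\<lambda>t. F (x + t *\<^sub>R d)) has_real_derivative D (x + t *\<^sub>R d)) (at t)"
      using DERIV_cong_ev[OF refl ev refl] by iprover
    then show ?thesis by (simp add: has_field_derivative_def mult_commute_abs)
  qed
  obtain z where "z \<in> {0<..<h}" "F (x + h *\<^sub>R d) - F (x + 0 *\<^sub>R d) = (h - 0) * D (x + z *\<^sub>R d)"
    using mvt[OF h cont der] by auto
  then show thesis using that[of z] by simp
qed

lemma segment_increment_bound:
  fixes f :: "'a::real_normed_vector \<Rightarrow> real"
  assumes F: "continuous_on UNIV F" "\<And>y. y \<in> S \<Longrightarrow> F y = f y" and "open S"
    and D: "\<And>y. y \<in> S \<Longrightarrow> ((\<lambda>t. f (y + t *\<^sub>R d)) has_real_derivative D y) (at 0)"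
    and M: "\<And>y. y \<in> S \<Longrightarrow> \<bar>D y\<bar> \<le> M" and "M \<ge> 0" and "0 \<le> h"
    and seg: "\<And>t. 0 < t \<Longrightarrow> t < h \<Longrightarrow> x + t *\<^sub>R d \<in> S"
  shows "\<bar>F (x + h *\<^sub>R d) - F x\<bar> \<le> M * h"
proof (cases "h = 0")
  case False
  then have h: "h > 0" using \<open>0 \<le> h\<close> by simp
  obtain z where z: "0 < z" "z < h" "F (x + h *\<^sub>R d) - F x = h * D (x + z *\<^sub>R d)"
    using segment_mvt[OF F \<open>open S\<close> D h seg] by blast
  have "h * \<bar>D (x + z *\<^sub>R d)\<bar> \<le> h * M"
    using M seg z(1,2) h by (intro mult_left_mono) auto
  then show ?thesis using z h by (simp add: abs_mult mult.commute)
qed simp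

text \<open>The mean value bound applies up to the first parameter at which the ray meets the
  complement of S, and F is 0 there.\<close>

lemma exit_bound:
  fixes f :: "'a::real_normed_vector \<Rightarrow> real"
  assumes F: "continuous_on UNIV F" "\<And>y. y \<in> S \<Longrightarrow> F y = f y" "\<And>y. y \<notin> S \<Longrightarrow> F y = 0" and "open S"
    and D: "\<And>y. y \<in> S \<Longrightarrow> ((\<lambda>t. f (y + t *\<^sub>R d)) has_real_derivative D y) (at 0)"
    and M: "\<And>y. y \<in> S \<Longrightarrow> \<bar>D y\<bar> \<le> M" and "M \<ge> 0" and "0 \<le> h"
    and out: "x + h *\<^sub>R d \<notin> S"
  shows "\<bar>F x\<bar> \<le> M * h"
proof -
  \<comment> \<open>A compact set containing h, so there is a first exit parameter; it is 0 if x is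
    already outside.\<close>
  define E where "E = {0..h} \<inter> (\<lambda>t. x + t *\<^sub>R d) -` (- S)"
  have "closed ((\<lambda>t. x + t *\<^sub>R d) -` (- S))"
    using \<open>open S\<close> by (intro continuous_closed_vimage) (auto intro!: continuous_intros)
  then have "compact E" unfolding E_def by (intro compact_Int_closed) auto
  moreover have "h \<in> E" using out \<open>0 \<le> h\<close> by (simp add: E_def)
  ultimately obtain s where s: "s \<in> E" "\<And>t. t \<in> E \<Longrightarrow> s \<le> t"
    using compact_attains_inf[of E] by blast
  have "x + t *\<^sub>R d \<in> S" if "0 < t" "t < s" for t
    using s(1) s(2)[of t] that by (auto simp: E_def)
  with segment_increment_bound[OF F(1,2) \<open>open S\<close> D M \<open>M \<ge> 0\<close>, of s x] s(1)
  have "\<bar>F (x + s *\<^sub>R d) - F x\<bar> \<le> M * s" by (auto simp: E_def)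
  moreover have "F (x + s *\<^sub>R d) = 0" using s(1) F(3) by (auto simp: E_def)
  moreover have "M * s \<le> M * h" using s(1) \<open>M \<ge> 0\<close> by (auto simp: E_def mult_left_mono)
  ultimately show ?thesis by simp
qed

text \<open>A segment that leaves S at parameter s passes through a zero of F. Bounding both ends
  against that zero, one of them in direction -d, gives M * s + M * (h - s).\<close>

lemma zero_extension_lipschitz:
  fixes f :: "'a::real_normed_vector \<Rightarrow> real"
  assumes F: "continuous_on UNIV F" "\<And>y. y \<in> S \<Longrightarrow> F y = f y" "\<And>y. y \<notin> S \<Longrightarrow> F y = 0" and "open S"
    and D: "\<And>y. y \<in> S \<Longrightarrow> ((\<lambda>t. f (y + t *\<^sub>R d)) has_real_derivative D y) (at 0)"
    and M: "\<And>y. y \<in> S \<Longrightarrow> \<bar>D y\<bar> \<le> M" and "M \<ge> 0" and "0 \<le> h"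
  shows "\<bar>F (x + h *\<^sub>R d) - F x\<bar> \<le> M * h"
proof (cases "\<exists>s. 0 < s \<and> s < h \<and> x + s *\<^sub>R d \<notin> S")
  case True
  then obtain s where s: "0 < s" "s < h" "x + s *\<^sub>R d \<notin> S" by blast
  have "((\<lambda>t. f (y + t *\<^sub>R (- d))) has_real_derivative - D y) (at 0)" if "y \<in> S" for y
    using DERIV_mirror[of "\<lambda>t. f (y + t *\<^sub>R d)" "D y" 0] D[OF that] by simp
  from exit_bound[OF F \<open>open S\<close> this, of M "h - s" "x + h *\<^sub>R d"] M \<open>M \<ge> 0\<close> s
  have "\<bar>F (x + h *\<^sub>R d)\<bar> \<le> M * (h - s)" by (simp add: algebra_simps)
  moreover have "\<bar>F x\<bar> \<le> M * s"
    using exit_bound[OF F \<open>open S\<close> D M \<open>M \<ge> 0\<close> _ s(3)] s by simp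
  ultimately show ?thesis by (simp add: algebra_simps)
next
  case False
  then show ?thesis
    using segment_increment_bound[OF F(1,2) \<open>open S\<close> D M \<open>M \<ge> 0\<close> \<open>0 \<le> h\<close>] by blast
qed

section \<open>The divergence theorem for fields vanishing on the boundary\<close>

lemma ext_cont_set_integrable:
  fixes S :: "(real^'n::finite) set"
  assumes "open S" "bounded S" "ext_cont S f"
  shows "set_integrable lborel S f"
proof -
  obtain M where M: "M \<ge> 0" "\<And>x. x \<in> S \<Longrightarrow> \<bar>f x\<bar> \<le> M"
    using ext_cont_bounded[OF assms(2,3)] by blast
  have intS: "integrable lborel (\<lambda>x. M * indicator S x)"
    using assms(1) emeasure_bounded_finite[OF assms(2)] by simp
  have meas: "(\<lambda>x. indicator S x *\<^sub>R f x) \<in> borel_measurable lborel"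
    using borel_measurable_continuous_on_indicator[OF _ ext_cont_imp_continuous_on[OF assms(3)]] assms(1)
    by simp
  show ?thesis unfolding set_integrable_def
    by (rule Bochner_Integration.integrable_bound[OF intS meas])
      (use M in \<open>auto simp: indicator_def\<close>)
qed

lemma ext_cont_integrable_on:
  fixes S :: "(real^'n::finite) set"
  assumes "open S" "bounded S" "ext_cont S f"
  shows "f integrable_on S"
  using set_borel_integral_eq_integral(1)[OF ext_cont_set_integrable[OF assms]] .

lemma lborel_translation:
  fixes f :: "'a::euclidean_space \<Rightarrow> real"
  assumes "integrable lborel f"
  shows "integrable lborel (\<lambda>x. f (x + a))" "(\<integral>x. f (x + a) \<partial>lborel) = (\<integral>x. f x \<partial>lborel)"
proof -
  have f: "f \<in> borel_measurable borel" using assms by simp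
  have "integrable (distr lborel borel ((+) a)) f" using assms by (simp add: lborel_distr_plus)
  then show "integrable lborel (\<lambda>x. f (x + a))"
    using f by (subst (asm) integrable_distr_eq) (auto simp: add.commute)
  have "(\<integral>x. f x \<partial>lborel) = (\<integral>x. f x \<partial>distr lborel borel ((+) a))" by (simp add: lborel_distr_plus)
  also have "\<dots> = (\<integral>x. f (x + a) \<partial>lborel)"
    using f by (subst integral_distr) (auto simp: add.commute)
  finally show "(\<integral>x. f (x + a) \<partial>lborel) = (\<integral>x. f x \<partial>lborel)" ..
qed

lemma integral_hpart_vanishing:
  fixes S :: "(real^'n::finite) set"
  assumes "open S" "bounded S" and hp: "hpart S i f f'"
    and ef: "ext_cont S f" and ef': "ext_cont S f'" and van: "vanishing S f"
  shows "integral S f' = 0"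
proof -
  define F where "F = (\<lambda>x. if x \<in> S then f x else 0)"
  define e :: "real^'n" where "e = axis i 1"
  define h where "h n = 1 / real (Suc n)" for n
  define D where "D n x = (F (x + h n *\<^sub>R e) - F x) / h n" for n x
  have h0: "h n > 0" for n by (simp add: h_def)
  have hlim: "h \<longlonglongrightarrow> 0" unfolding h_def by (rule LIMSEQ_Suc[OF lim_1_over_n])
  obtain M where M: "M \<ge> 0" "\<And>x. x \<in> S \<Longrightarrow> \<bar>f' x\<bar> \<le> M"
    using ext_cont_bounded[OF assms(2) ef'] by blast
  have contF: "continuous_on UNIV F"
    unfolding F_def using assms(1) ext_cont_imp_continuous_on[OF ef] van
    by (rule continuous_zero_extension)
  have lip: "\<bar>F (x + t *\<^sub>R e) - F x\<bar> \<le> M * t" if "0 \<le> t" for x t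
    by (rule zero_extension_lipschitz[OF contF _ _ assms(1) _ M(2) M(1) that, where f=f])
      (use hp in \<open>auto simp: F_def hpart_def e_def\<close>)
  \<comment> \<open>This bound holds on the whole space, also across the boundary; it dominates the
    quotients on S and controls them off S.\<close>
  have boundD: "\<bar>D n x\<bar> \<le> M" for n x
    using lip[of "h n" x] h0[of n] by (simp add: D_def abs_div_pos[symmetric] pos_divide_le_eq)
  have intF: "integrable lborel F"
    using ext_cont_set_integrable[OF assms(1,2) ef]
    unfolding set_integrable_def
    by (rule back_subst[of "integrable lborel"]) (auto simp: F_def fun_eq_iff)
  have intD: "integrable lborel (D n)" for n
    unfolding D_def using intF lborel_translation(1)[OF intF] by simp
  have zero: "(\<integral>x. D n x \<partial>lborel) = 0" for n
    unfolding D_def using intF lborel_translation[OF intF]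
    by (simp add: Bochner_Integration.integral_diff)
  have measS: "S \<in> sets lborel" using assms(1) by simp
  have intS: "integrable lborel (indicator S :: _ \<Rightarrow> real)"
    using measS emeasure_bounded_finite[OF assms(2)] by simp
  have measSh: "(\<lambda>x. indicator S (x + h n *\<^sub>R e) :: real) \<in> borel_measurable lborel" for n
    using lborel_translation(1)[OF intS] by (rule borel_measurable_integrable)
  have inside: "(\<lambda>n. \<integral>x. indicator S x * D n x \<partial>lborel) \<longlonglongrightarrow> (\<integral>x. indicator S x * f' x \<partial>lborel)"
  proof (rule integral_dominated_convergence[where w="\<lambda>x. indicator S x * M"])
    show "(\<lambda>x. indicator S x * f' x) \<in> borel_measurable lborel"
      using ext_cont_set_integrable[OF assms(1,2) ef'] by (simp add: set_integrable_def)
    show "integrable lborel (\<lambda>x. indicator S x * M)" using intS by simp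
    show "(\<lambda>x. indicator S x * D n x) \<in> borel_measurable lborel" for n
      using intD[of n] measS by (intro borel_measurable_times borel_measurable_indicator) auto
    show "AE x in lborel. norm (indicator S x * D n x) \<le> indicator S x * M" for n
      using boundD by (auto simp: indicator_def)
    show "AE x in lborel. (\<lambda>n. indicator S x * D n x) \<longlonglongrightarrow> indicator S x * f' x"
    proof (intro AE_I2)
      fix x
      show "(\<lambda>n. indicator S x * D n x) \<longlonglongrightarrow> indicator S x * f' x"
      proof (cases "x \<in> S")
        case True
        have ev: "\<forall>\<^sub>F t in nhds 0. f (x + t *\<^sub>R e) = F (x + t *\<^sub>R e)"
          using eventually_line_in_open[OF assms(1) True, of e] by eventually_elim (simp add: F_def)
        have "((\<lambda>t. f (x + t *\<^sub>R e)) has_real_derivative f' x) (at 0)"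
          using hp True by (simp add: hpart_def e_def)
        then have "((\<lambda>t. F (x + t *\<^sub>R e)) has_real_derivative f' x) (at 0)"
          using DERIV_cong_ev[OF refl ev refl] by iprover
        then have "((\<lambda>t. (F (x + t *\<^sub>R e) - F x) / t) \<longlongrightarrow> f' x) (at 0)"
          by (simp add: DERIV_def)
        moreover have "filterlim h (at 0) sequentially"
          using hlim h0 by (auto simp: filterlim_at less_imp_neq[symmetric])
        ultimately show ?thesis using True filterlim_compose by (fastforce simp: D_def)
      qed simp
    qed
  qed
  text \<open>Outside \<open>S\<close> the quotient lives on the set of points pushed into \<open>S\<close>, whose measure tends to
    zero; so the boundary need not be known to be a null set.\<close>
  have pushed: "(\<lambda>n. \<integral>x. indicator S x * indicator S (x + h n *\<^sub>R e) \<partial>lborel) \<longlonglongrightarrow> (\<integral>x. indicator S x \<partial>lborel :: real)"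
  proof (rule integral_dominated_convergence[where w="indicator S"])
    show "(\<lambda>x. indicator S x * indicator S (x + h n *\<^sub>R e) :: real) \<in> borel_measurable lborel" for n
      using measS measSh by (intro borel_measurable_times borel_measurable_indicator)
    show "AE x in lborel. (\<lambda>n. indicator S x * indicator S (x + h n *\<^sub>R e) :: real) \<longlonglongrightarrow> indicator S x"
    proof (intro AE_I2)
      fix x
      show "(\<lambda>n. indicator S x * indicator S (x + h n *\<^sub>R e) :: real) \<longlonglongrightarrow> indicator S x"
      proof (cases "x \<in> S")
        case True
        have "\<forall>\<^sub>F n in sequentially. x + h n *\<^sub>R e \<in> S"
          using hlim eventually_line_in_open[OF assms(1) True, of e] by (auto simp: filterlim_iff)
        then have "\<forall>\<^sub>F n in sequentially. 1 = (indicator S x * indicator S (x + h n *\<^sub>R e) :: real)"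
          by eventually_elim (simp add: True)
        then show ?thesis using True by (auto intro: Lim_transform_eventually[OF tendsto_const])
      qed simp
    qed
  qed (use intS measS in \<open>auto simp: indicator_def\<close>)
  have outside: "(\<lambda>n. \<integral>x. indicator (- S) x * D n x \<partial>lborel) \<longlonglongrightarrow> 0"
  proof (rule Lim_null_comparison)
    let ?g = "\<lambda>n. M * ((\<integral>x. indicator S x \<partial>lborel) - (\<integral>x. indicator S x * indicator S (x + h n *\<^sub>R e) \<partial>lborel))"
    have "?g \<longlonglongrightarrow> M * ((\<integral>x. indicator S x \<partial>lborel) - (\<integral>x. indicator S x \<partial>lborel))"
      by (intro tendsto_intros pushed)
    then show "?g \<longlonglongrightarrow> 0" by simp
    show "\<forall>\<^sub>F n in sequentially. norm (\<integral>x. indicator (- S) x * D n x \<partial>lborel) \<le> ?g n"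
    proof (intro always_eventually allI)
      fix n
      have i1: "integrable lborel (\<lambda>x. indicator S (x + h n *\<^sub>R e) :: real)"
        by (rule lborel_translation(1)[OF intS])
      have i2: "integrable lborel (\<lambda>x. indicator S x * indicator S (x + h n *\<^sub>R e) :: real)"
        by (rule Bochner_Integration.integrable_bound[OF intS])
          (use measS measSh in \<open>auto simp: indicator_def intro!: borel_measurable_times\<close>)
      \<comment> \<open>Off S the quotient can be nonzero only at points that the shift moves into
        S, and \<open>?w\<close> is M times the indicator of that set. By translation invariance its
        integral is M times the measure of S minus that of the overlap of S with its
        translate.\<close>
      let ?w = "\<lambda>x. M * (indicator S (x + h n *\<^sub>R e) - indicator S x * indicator S (x + h n *\<^sub>R e))"
      have le: "norm (indicator (- S) x * D n x) \<le> ?w x" for x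
        using boundD[of n x] by (auto simp: indicator_def D_def F_def)
      have "norm (\<integral>x. indicator (- S) x * D n x \<partial>lborel) \<le> (\<integral>x. ?w x \<partial>lborel)"
      proof (rule Bochner_Integration.integral_norm_bound_integral)
        show "integrable lborel (\<lambda>x. indicator (- S) x * D n x)"
          by (rule Bochner_Integration.integrable_bound[OF intD[of n]])
            (use measS intD[of n] in \<open>auto simp: indicator_def intro!: borel_measurable_times\<close>)
        show "integrable lborel ?w" using i1 i2 by auto
      qed (use le in auto)
      also have "\<dots> = ?g n"
        using i1 i2 lborel_translation(2)[OF intS, of "h n *\<^sub>R e"]
        by (simp add: Bochner_Integration.integral_diff)
      finally show "norm (\<integral>x. indicator (- S) x * D n x \<partial>lborel) \<le> ?g n" .
    qed
  qed
  \<comment> \<open>The total integral is 0, so the part over S inherits the limit 0 from the part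
    outside.\<close>
  have "(\<integral>x. indicator S x * D n x \<partial>lborel) = - (\<integral>x. indicator (- S) x * D n x \<partial>lborel)" for n
  proof -
    have "(\<integral>x. indicator S x * D n x \<partial>lborel) + (\<integral>x. indicator (- S) x * D n x \<partial>lborel)
      = (\<integral>x. indicator S x * D n x + indicator (- S) x * D n x \<partial>lborel)"
      by (rule Bochner_Integration.integral_add[symmetric];
          rule Bochner_Integration.integrable_bound[OF intD[of n]])
        (use measS intD[of n] in \<open>auto simp: indicator_def intro!: borel_measurable_times\<close>)
    also have "\<dots> = (\<integral>x. D n x \<partial>lborel)"
      by (rule Bochner_Integration.integral_cong) (auto simp: indicator_def)
    finally show ?thesis using zero by simp
  qed
  with inside have "(\<lambda>n. - (\<integral>x. indicator (- S) x * D n x \<partial>lborel)) \<longlonglongrightarrow> (\<integral>x. indicator S x * f' x \<partial>lborel)"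
    by simp
  then have "(\<integral>x. indicator S x * f' x \<partial>lborel) = 0"
    using tendsto_minus[OF outside] LIMSEQ_unique by fastforce
  then show ?thesis
    using set_borel_integral_eq_integral(2)[OF ext_cont_set_integrable[OF assms(1,2) ef']]
    by (simp add: set_lebesgue_integral_def)
qed

lemma integral_divergence_vanishing:
  fixes S :: "(real^'n::finite) set"
  assumes "open S" "bounded S" and "\<And>i. hpart S i (X i) (X' i)"
    and "\<And>i. ext_cont S (X i)" and "\<And>i. ext_cont S (X' i)" and "\<And>i. vanishing S (X i)"
  shows "integral S (\<lambda>x. \<Sum>i\<in>UNIV. X' i x) = 0"
proof -
  have "integral S (X' i) = 0" for i
    by (rule integral_hpart_vanishing[OF assms(1-6)])
  then show ?thesis
    by (subst integral_sum) (auto intro: ext_cont_integrable_on assms)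
qed

section \<open>Gradients at the boundary\<close>

lemma has_derivative_line:
  fixes f :: "'a::real_normed_vector \<Rightarrow> real"
  assumes "(f has_derivative f') (at x)"
  shows "((\<lambda>t. f (x + t *\<^sub>R d)) has_real_derivative f' d) (at 0)"
proof -
  have "((\<lambda>t. x + t *\<^sub>R d) has_derivative (\<lambda>t. t *\<^sub>R d)) (at 0)"
    by (auto intro!: derivative_eq_intros)
  from has_derivative_compose[OF this, of f f'] assms
  have "((\<lambda>t. f (x + t *\<^sub>R d)) has_derivative (\<lambda>t. f' (t *\<^sub>R d))) (at 0)" by simp
  moreover have "f' (t *\<^sub>R d) = f' d * t" for t
    using assms by (simp add: bounded_linear.linear has_derivative_bounded_linear linear_cmul)
  ultimately show ?thesis by (simp add: has_field_derivative_def)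
qed

text \<open>Along the inward direction \<open>\<tau> - \<delta>v\<close> the function changes at rate about \<open>l \<bullet> (\<tau> - \<delta>v)\<close>,
  while the points on that ray stay within \<open>O(\<delta>t)\<close> of the complement of \<open>S\<close>, where it vanishes.\<close>

lemma boundary_gradient_orthogonal:
  fixes S :: "(real^'n::finite) set"
  assumes "open S" "bounded S" and hp: "\<And>i. hpart S i f (f' i)"
    and ef: "ext_cont S f" and ef': "\<And>i. ext_cont S (f' i)" and van: "vanishing S f"
    and p: "p \<in> frontier S" and lim: "\<And>i. (f' i \<longlongrightarrow> l $ i) (at p within S)"
    and phi: "(\<phi> has_derivative (\<lambda>h. h \<bullet> v)) (at p)" and "v \<noteq> 0" and "r > 0"
    and S: "S \<inter> ball p r = {x \<in> ball p r. \<phi> x < 0}" and tau: "\<tau> \<bullet> v = 0"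
  shows "l \<bullet> \<tau> = 0"
proof -
  define F where "F = (\<lambda>x. if x \<in> S then f x else 0)"
  define D where "D d x = (\<Sum>i\<in>UNIV. d $ i * f' i x)" for d x
  have contF: "continuous_on UNIV F"
    unfolding F_def using assms(1) ext_cont_imp_continuous_on[OF ef] van
    by (rule continuous_zero_extension)
  have F: "\<And>y. y \<in> S \<Longrightarrow> F y = f y" "\<And>y. y \<notin> S \<Longrightarrow> F y = 0" by (auto simp: F_def)
  have D: "((\<lambda>t. f (y + t *\<^sub>R d)) has_real_derivative D d y) (at 0)" if "y \<in> S" for d y
    unfolding D_def
    by (rule has_derivative_line, rule hpart_has_derivative[OF assms(1) that hp])
      (rule ext_cont_imp_continuous_on[OF ef'])
  have "ext_cont S (D d)" for d
    unfolding D_def by (intro ext_cont_intros ef')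
  then obtain M where M: "M \<ge> 0" "\<And>x. x \<in> S \<Longrightarrow> \<bar>D v x\<bar> \<le> M"
    using ext_cont_bounded[OF assms(2)] by blast
  have limD: "(D d \<longlongrightarrow> l \<bullet> d) (at p within S)" for d
    unfolding D_def inner_vec_def by (auto intro!: tendsto_eq_intros lim simp: mult.commute)
  have pS: "p \<notin> S" using p assms(1) by (simp add: frontier_def interior_open)
  have inS: "x \<in> S \<longleftrightarrow> \<phi> x < 0" if "x \<in> ball p r" for x
    using S that by blast
  \<comment> \<open>p lies outside S, so phi is nonnegative there; a positive value would persist
    nearby and keep S away from p.\<close>
  have phip: "\<phi> p = 0"
  proof (rule antisym)
    show "\<phi> p \<ge> 0" using pS inS[of p] \<open>r > 0\<close> by simp
    show "\<phi> p \<le> 0"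
    proof (rule ccontr)
      assume "\<not> \<phi> p \<le> 0"
      moreover have "(\<phi> \<longlongrightarrow> \<phi> p) (nhds p)"
        using has_derivative_continuous[OF phi] by (simp add: continuous_within tendsto_at_iff_tendsto_nhds)
      ultimately have "\<forall>\<^sub>F x in nhds p. \<phi> x > 0" by (intro order_tendstoD) auto
      moreover have "\<forall>\<^sub>F x in nhds p. x \<in> ball p r" using \<open>r > 0\<close> by (intro eventually_nhds_in_open) auto
      ultimately have "\<forall>\<^sub>F x in nhds p. x \<notin> S"
        by eventually_elim (use inS in force)
      then show False using p unfolding frontier_def closure_iff_nhds_not_empty eventually_nhds
        by (metis Diff_iff Int_emptyI closure_iff_nhds_not_empty order_refl)
    qed
  qed
  have inball: "\<forall>\<^sub>F t in at_right 0. p + t *\<^sub>R d \<in> ball p r" for d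
    using eventually_line_in_open[of "ball p r" p d] \<open>r > 0\<close>
    by (auto simp: eventually_at_filter elim: eventually_mono)
  have along: "((\<lambda>t. \<phi> (p + t *\<^sub>R d)) has_real_derivative d \<bullet> v) (at 0)" for d
    by (rule has_derivative_line[OF phi])
  have bound: "\<bar>l \<bullet> (\<tau> - \<delta> *\<^sub>R v)\<bar> \<le> 2 * M * \<delta>" if "\<delta> > 0" for \<delta>
  proof (rule field_le_epsilon)
    fix \<epsilon> :: real assume "\<epsilon> > 0"
    \<comment> \<open>Tilting tau slightly against v gives a ray along which phi decreases to first
      order, so it starts into S; tilting towards v gives a ray that starts out of S.\<close>
    let ?d = "\<tau> - \<delta> *\<^sub>R v" and ?d' = "\<tau> + \<delta> *\<^sub>R v"
    have vv: "v \<bullet> v > 0" using \<open>v \<noteq> 0\<close> by simp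
    have neg: "?d \<bullet> v < 0" and pos: "?d' \<bullet> v > 0"
      using vv tau that by (simp_all add: inner_diff_left inner_add_left)
    have evneg: "\<forall>\<^sub>F t in at_right 0. p + t *\<^sub>R ?d \<in> S"
    proof -
      obtain t0 where "t0 > 0" "\<And>t. t > 0 \<Longrightarrow> t < t0 \<Longrightarrow> \<phi> (p + t *\<^sub>R ?d) < 0"
        using DERIV_neg_dec_right[OF along neg] phip by auto
      then have "\<forall>\<^sub>F t in at_right 0. \<phi> (p + t *\<^sub>R ?d) < 0"
        unfolding eventually_at_right_field by (intro exI[of _ t0]) auto
      then show ?thesis using inball by eventually_elim (use inS in force)
    qed
    have evpos: "\<forall>\<^sub>F t in at_right 0. p + t *\<^sub>R ?d' \<notin> S"
    proof -
      obtain t0 where "t0 > 0" "\<And>t. t > 0 \<Longrightarrow> t < t0 \<Longrightarrow> \<phi> (p + t *\<^sub>R ?d') > 0"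
        using DERIV_pos_inc_right[OF along pos] phip by auto
      then have "\<forall>\<^sub>F t in at_right 0. \<phi> (p + t *\<^sub>R ?d') > 0"
        unfolding eventually_at_right_field by (intro exI[of _ t0]) auto
      then show ?thesis using inball by eventually_elim (use inS in force)
    qed
    have "\<forall>\<^sub>F t in at_right 0. p + t *\<^sub>R ?d \<in> S \<longrightarrow> \<bar>D ?d (p + t *\<^sub>R ?d) - l \<bullet> ?d\<bar> < \<epsilon>"
    proof -
      have "((\<lambda>t. p + t *\<^sub>R ?d) \<longlongrightarrow> p + 0 *\<^sub>R ?d) (at_right 0)"
        by (intro tendsto_intros)
      moreover have "\<forall>\<^sub>F x in nhds p. x \<in> S \<longrightarrow> \<bar>D ?d x - l \<bullet> ?d\<bar> < \<epsilon>"
      proof -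
        have "\<forall>\<^sub>F x in at p within S. \<bar>D ?d x - l \<bullet> ?d\<bar> < \<epsilon>"
          using limD[of ?d] \<open>\<epsilon> > 0\<close> by (auto simp: tendsto_iff dist_real_def)
        then show ?thesis using pS unfolding eventually_at_filter by (auto elim: eventually_mono)
      qed
      ultimately show ?thesis by (auto simp: filterlim_iff)
    qed
    with evneg evpos have "\<forall>\<^sub>F t in at_right 0. p + t *\<^sub>R ?d \<in> S \<and> p + t *\<^sub>R ?d' \<notin> S \<and>
        \<bar>D ?d (p + t *\<^sub>R ?d) - l \<bullet> ?d\<bar> < \<epsilon>" by eventually_elim auto
    then obtain T where T: "T > 0" "\<And>t. 0 < t \<Longrightarrow> t < T \<Longrightarrow> p + t *\<^sub>R ?d \<in> S \<and> p + t *\<^sub>R ?d' \<notin> S \<and>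
        \<bar>D ?d (p + t *\<^sub>R ?d) - l \<bullet> ?d\<bar> < \<epsilon>"
      by (auto simp: eventually_at_right_field)
    define h where "h = T / 2"
    have h: "0 < h" "h < T" using T(1) by (auto simp: h_def)
    \<comment> \<open>The inward ray at parameter h is 2 * delta * h * v away from the outside point
      on the other ray, so F is at most M * 2 * delta * h there. On the other hand F has grown from
      F p = 0 at a rate within epsilon of l . d.\<close>
    have "(2 * \<delta> * h) *\<^sub>R v = (h * \<delta>) *\<^sub>R v + (h * \<delta>) *\<^sub>R v"
      by (simp flip: scaleR_add_left)
    then have "p + h *\<^sub>R ?d + (2 * \<delta> * h) *\<^sub>R v = p + h *\<^sub>R ?d'"
      by (simp add: scaleR_diff_right scaleR_add_right)
    then have out: "p + h *\<^sub>R ?d + (2 * \<delta> * h) *\<^sub>R v \<notin> S"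
      using T(2)[OF h] by (simp only: not_False_eq_True)
    have "\<bar>F (p + h *\<^sub>R ?d)\<bar> \<le> M * (2 * \<delta> * h)"
      by (rule exit_bound[OF contF F assms(1) D M(2,1) _ out]) (use that h in auto)
    moreover have seg: "p + t *\<^sub>R ?d \<in> S" if "0 < t" "t < h" for t
      using T(2)[of t] that h by auto
    obtain z where z: "0 < z" "z < h" "F (p + h *\<^sub>R ?d) - F p = h * D ?d (p + z *\<^sub>R ?d)"
      using segment_mvt[OF contF F(1) assms(1) D h(1) seg] by blast
    ultimately have "h * \<bar>D ?d (p + z *\<^sub>R ?d)\<bar> \<le> h * (2 * M * \<delta>)"
      using z(3) h(1) F(2)[OF pS] by (simp add: abs_mult mult_ac)
    then have "\<bar>D ?d (p + z *\<^sub>R ?d)\<bar> \<le> 2 * M * \<delta>" using h by simp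
    moreover have "\<bar>D ?d (p + z *\<^sub>R ?d) - l \<bullet> ?d\<bar> < \<epsilon>" using T(2)[of z] z h by auto
    ultimately show "\<bar>l \<bullet> ?d\<bar> \<le> 2 * M * \<delta> + \<epsilon>" by linarith
  qed
  \<comment> \<open>Replacing tau - delta v by tau costs delta * |l . v|, so the whole bound tends
    to 0 with delta.\<close>
  have lin: "\<bar>l \<bullet> \<tau>\<bar> \<le> \<delta> * (2 * M + \<bar>l \<bullet> v\<bar>)" if "\<delta> > 0" for \<delta>
  proof -
    have "l \<bullet> \<tau> = l \<bullet> (\<tau> - \<delta> *\<^sub>R v) + \<delta> * (l \<bullet> v)" by (simp add: inner_diff_right)
    then have "\<bar>l \<bullet> \<tau>\<bar> \<le> \<bar>l \<bullet> (\<tau> - \<delta> *\<^sub>R v)\<bar> + \<bar>\<delta> * (l \<bullet> v)\<bar>" by linarith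
    also have "\<dots> \<le> 2 * M * \<delta> + \<delta> * \<bar>l \<bullet> v\<bar>" using bound[OF that] that by (simp add: abs_mult)
    finally show ?thesis by (simp add: algebra_simps)
  qed
  have "\<bar>l \<bullet> \<tau>\<bar> \<le> 0"
  proof (rule field_le_epsilon)
    fix \<epsilon> :: real assume "\<epsilon> > 0"
    \<comment> \<open>The added 1 makes K positive, so delta = epsilon / K is admissible and delta *
      (K - 1) is at most epsilon.\<close>
    define K where "K = 2 * M + \<bar>l \<bullet> v\<bar> + 1"
    have K: "K > 0" using M by (simp add: K_def)
    have "\<bar>l \<bullet> \<tau>\<bar> \<le> \<epsilon> / K * (K - 1)" using lin[of "\<epsilon> / K"] K \<open>\<epsilon> > 0\<close> by (simp add: K_def)
    also have "\<dots> \<le> 0 + \<epsilon>" using K \<open>\<epsilon> > 0\<close> by (simp add: field_simps)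
    finally show "\<bar>l \<bullet> \<tau>\<bar> \<le> 0 + \<epsilon>" .
  qed
  then show ?thesis by simp
qed

lemma Ck_on_hpart: "Ck_on k f S \<Longrightarrow> length js < k \<Longrightarrow> hpart S i (dpart js f) (dpart (i # js) f)"
  unfolding Ck_on_def hpart_def
  by (auto simp: pd_def[abs_def] DERIV_deriv_iff_real_differentiable)

lemma Ck_on_continuous_on: "Ck_on k f S \<Longrightarrow> length js \<le> k \<Longrightarrow> continuous_on S (dpart js f)"
  unfolding Ck_on_def by blast

lemma Ck_on_mono: "Ck_on k f S \<Longrightarrow> m \<le> k \<Longrightarrow> Ck_on m f S"
  unfolding Ck_on_def by auto

text \<open>\<open>outward_normal\<close> is a choice; this recovers the radius and the defining
  function that belong to the chosen vector, on which the later arguments about the normal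
  rest.\<close>

lemma outward_normal_defining_function:
  assumes "Ck_alpha_boundary k \<alpha> S" "1 \<le> k" "p \<in> frontier S"
  obtains r \<phi> where "r > 0" "Ck_on 1 \<phi> (ball p r)" "\<forall>x\<in>ball p r. grad \<phi> x \<noteq> 0"
    "S \<inter> ball p r = {x \<in> ball p r. \<phi> x < 0}"
    "outward_normal S p = (1 / norm (grad \<phi> p)) *\<^sub>R grad \<phi> p"
proof -
  obtain r \<phi> where "r > 0" "Ck_on k \<phi> (ball p r)" "\<forall>x\<in>ball p r. grad \<phi> x \<noteq> 0"
    "S \<inter> ball p r = {x \<in> ball p r. \<phi> x < 0}"
    using assms unfolding Ck_alpha_boundary_def by blast
  then have "\<exists>\<nu> r \<phi>. r > 0 \<and> Ck_on 1 \<phi> (ball p r) \<and> (\<forall>x\<in>ball p r. grad \<phi> x \<noteq> 0) \<and>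
      S \<inter> ball p r = {x \<in> ball p r. \<phi> x < 0} \<and> \<nu> = (1 / norm (grad \<phi> p)) *\<^sub>R grad \<phi> p"
    using Ck_on_mono[OF _ assms(2)] by blast
  from someI_ex[OF this] that show thesis unfolding outward_normal_def by blast
qed

text \<open>The tangential part tau of l satisfies l . tau = 0 by the ray argument and tau . nu = 0
  by construction, hence tau . tau = 0.\<close>

lemma boundary_gradient_normal:
  fixes S :: "(real^'n::finite) set"
  assumes "open S" "bounded S" and "\<And>i. hpart S i f (f' i)"
    and "ext_cont S f" and "\<And>i. ext_cont S (f' i)" and "vanishing S f"
    and "Ck_alpha_boundary k \<alpha> S" "1 \<le> k"
    and "p \<in> frontier S" and "\<And>i. (f' i \<longlongrightarrow> l $ i) (at p within S)"
  shows "norm (outward_normal S p) = 1" and "l = (l \<bullet> outward_normal S p) *\<^sub>R outward_normal S p"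
proof -
  obtain r \<phi> where phi: "r > 0" "Ck_on 1 \<phi> (ball p r)" "\<forall>x\<in>ball p r. grad \<phi> x \<noteq> 0"
    "S \<inter> ball p r = {x \<in> ball p r. \<phi> x < 0}"
    "outward_normal S p = (1 / norm (grad \<phi> p)) *\<^sub>R grad \<phi> p"
    using outward_normal_defining_function[OF assms(7-9)] .
  let ?v = "grad \<phi> p" and ?\<nu> = "outward_normal S p"
  have v: "?v \<noteq> 0" using phi(1,3) by simp
  then show nu: "norm ?\<nu> = 1" by (simp add: phi(5))
  have hp: "hpart (ball p r) i \<phi> (pd i \<phi>)" "continuous_on (ball p r) (pd i \<phi>)" for i
    using Ck_on_hpart[OF phi(2), of "[]" i] Ck_on_continuous_on[OF phi(2), of "[i]"] by simp_all
  have der: "(\<phi> has_derivative (\<lambda>h. h \<bullet> ?v)) (at p)"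
    using hpart_has_derivative[of "ball p r" p \<phi> "\<lambda>i. pd i \<phi>"] hp phi(1)
    by (simp add: inner_vec_def grad_def)
  define \<tau> where "\<tau> = l - (l \<bullet> ?\<nu>) *\<^sub>R ?\<nu>"
  have tn: "\<tau> \<bullet> ?\<nu> = 0" using nu by (simp add: \<tau>_def inner_diff_left dot_square_norm)
  then have "\<tau> \<bullet> ?v = 0" using v by (simp add: phi(5))
  then have "l \<bullet> \<tau> = 0"
    using boundary_gradient_orthogonal[OF assms(1-6,9,10) der v phi(1,4)] by blast
  then have "\<tau> \<bullet> \<tau> = 0" using tn by (simp add: \<tau>_def inner_diff_left inner_commute)
  then show "l = (l \<bullet> ?\<nu>) *\<^sub>R ?\<nu>" by (simp add: \<tau>_def)
qed

section \<open>The integral identity\<close>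

text \<open>U, V, T, Q stand for the derivatives of u of orders one to four, w, W, Z for the
  Laplacian with its gradient and Hessian, and \<gamma>, g1, g2 for g, g', g'' at u, so that every
  divergence is a finite sum of products. \<open>n\<close> may be any positive real: after division
  by n + 2 the identity depends on it only through a multiple of \<open>I4\<close>.\<close>

lemma overdetermined_biharmonic_identity:
  fixes S :: "(real^'n::finite) set"
  assumes op: "open S" and bd: "bounded S"
    and hU: "\<And>i j. hpart S i (U j) (V i j)" and hV: "\<And>i j k. hpart S i (V j k) (T i j k)"
    and hT: "\<And>i j k l. hpart S i (T j k l) (Q i j k l)"
    and hw: "\<And>i. hpart S i w (W i)" and hW: "\<And>i j. hpart S i (W j) (Z i j)"
    and h0: "\<And>i. hpart S i \<gamma> (\<lambda>x. g1 x * U i x)" and h1: "\<And>i. hpart S i g1 (\<lambda>x. g2 x * U i x)"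
    and hG: "\<And>i. hpart S i G (\<lambda>x. \<gamma> x * U i x)"
    and eU: "\<And>i. ext_cont S (U i)" and eV: "\<And>i j. ext_cont S (V i j)"
    and eT: "\<And>i j k. ext_cont S (T i j k)" and eQ: "\<And>i j k l. ext_cont S (Q i j k l)"
    and ew: "ext_cont S w" and eW: "\<And>i. ext_cont S (W i)" and eZ: "\<And>i j. ext_cont S (Z i j)"
    and e\<gamma>: "ext_cont S \<gamma>" and e1: "ext_cont S g1" and e2: "ext_cont S g2" and eG: "ext_cont S G"
    and symZ: "\<And>i j x. x \<in> S \<Longrightarrow> Z i j x = Z j i x"
    and w: "\<And>x. x \<in> S \<Longrightarrow> (\<Sum>i\<in>UNIV. V i i x) = w x"
    and W: "\<And>j x. x \<in> S \<Longrightarrow> (\<Sum>i\<in>UNIV. T i i j x) = W j x"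
    and Z: "\<And>j k x. x \<in> S \<Longrightarrow> (\<Sum>i\<in>UNIV. Q i i j k x) = Z j k x"
    and pde: "\<And>x. x \<in> S \<Longrightarrow> (\<Sum>i\<in>UNIV. Z i i x) = - \<gamma> x"
    and vU: "\<And>i. vanishing S (U i)" and vG: "vanishing S G" and vw: "vanishing S (\<lambda>x. w x - c)"
    and vV: "vanishing S (\<lambda>x. (\<Sum>i\<in>UNIV. \<Sum>j\<in>UNIV. (V i j x)\<^sup>2) - c\<^sup>2)"
    and n: "n > (0::real)"
  shows "integral S (\<lambda>x. (2 * (n + 2) * (3 * G x + c\<^sup>2)
             + (3 * n * w x - (n - 4) * c) * (w x - c)) * \<gamma> x)
       = 4 * (n + 2) * integral S (\<lambda>x. (w x - c) *
             ((\<Sum>i\<in>UNIV. \<Sum>j\<in>UNIV. \<Sum>k\<in>UNIV. (T i j k x)\<^sup>2) - 3 / (n + 2) * (\<Sum>i\<in>UNIV. (W i x)\<^sup>2)))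
         + (n + 2) * integral S (\<lambda>x. (\<Sum>i\<in>UNIV. (U i x)\<^sup>2) *
             (\<Sum>i\<in>UNIV. g2 x * U i x * U i x + g1 x * V i i x))"
proof -
  \<comment> \<open>In invariant notation: A is half of grad w . grad |D^2 u|^2, R = D^2 u : D^2 w,
    H = |D^2 u|^2, E = D^2 u(grad w, grad w), Y = D^2 w(grad u, grad w), B = D^2 u(grad u, grad u),
    and L is the Laplacian of g(u).\<close>
  define T3 where "T3 x = (\<Sum>i\<in>UNIV. \<Sum>j\<in>UNIV. \<Sum>k\<in>UNIV. (T i j k x)\<^sup>2)" for x
  define A where "A x = (\<Sum>i\<in>UNIV. W i x * (\<Sum>j\<in>UNIV. \<Sum>k\<in>UNIV. V j k x * T i j k x))" for x
  define R where "R x = (\<Sum>j\<in>UNIV. \<Sum>k\<in>UNIV. V j k x * Z j k x)" for x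
  define H where "H x = (\<Sum>j\<in>UNIV. \<Sum>k\<in>UNIV. (V j k x)\<^sup>2)" for x
  define E where "E x = (\<Sum>i\<in>UNIV. \<Sum>j\<in>UNIV. W i x * (V i j x * W j x))" for x
  define N where "N x = (\<Sum>i\<in>UNIV. (W i x)\<^sup>2)" for x
  define P where "P x = (\<Sum>i\<in>UNIV. U i x * W i x)" for x
  define Y where "Y x = (\<Sum>i\<in>UNIV. \<Sum>j\<in>UNIV. U i x * (Z i j x * W j x))" for x
  define B where "B x = (\<Sum>i\<in>UNIV. \<Sum>j\<in>UNIV. U i x * (V i j x * U j x))" for x
  define K where "K x = (\<Sum>i\<in>UNIV. (U i x)\<^sup>2)" for x
  define L where "L x = (\<Sum>i\<in>UNIV. g2 x * U i x * U i x + g1 x * V i i x)" for x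
  note ext = ext_cont_intros eU eV eT eQ ew eW eZ e\<gamma> e1 e2 eG
  note hp = hpart_mult hpart_diff hpart_const hpart_sum hpart_power2 hU hV hT hw hW h0 h1 hG
  have div: "(e has_integral 0) S"
    if "\<And>i. hpart S i (X i) (X' i)" "\<And>i. ext_cont S (X i)" "\<And>i. ext_cont S (X' i)" "\<And>i. vanishing S (X i)"
      and eq: "\<And>x. x \<in> S \<Longrightarrow> (\<Sum>i\<in>UNIV. X' i x) = e x" for X X' :: "'n \<Rightarrow> _ \<Rightarrow> real" and e
  proof (rule has_integral_eq[OF eq])
    have "ext_cont S (\<lambda>x. \<Sum>i\<in>UNIV. X' i x)" using that(3) by (rule ext_cont_sum)
    then have "(\<lambda>x. \<Sum>i\<in>UNIV. X' i x) integrable_on S" by (rule ext_cont_integrable_on[OF op bd])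
    then show "((\<lambda>x. \<Sum>i\<in>UNIV. X' i x) has_integral 0) S"
      using integral_divergence_vanishing[OF op bd that(1-4)] by (simp add: has_integral_integral)
  qed
  \<comment> \<open>Bochner: the Laplacian of |D^2 u|^2 / 2 is T3 + R. The weight w - c produces the
    wanted third order term, at the price of A and R.\<close>
  have I1: "((\<lambda>x. A x + (w x - c) * T3 x + (w x - c) * R x) has_integral 0) S"
  proof (rule div[where X="\<lambda>i x. (w x - c) * (\<Sum>j\<in>UNIV. \<Sum>k\<in>UNIV. V j k x * T i j k x)" and
        X'="\<lambda>i x. (W i x - 0) * (\<Sum>j\<in>UNIV. \<Sum>k\<in>UNIV. V j k x * T i j k x)
          + (w x - c) * (\<Sum>j\<in>UNIV. \<Sum>k\<in>UNIV. T i j k x * T i j k x + V j k x * Q i i j k x)"])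
    fix x assume x: "x \<in> S"
    have "R x = (\<Sum>j\<in>UNIV. \<Sum>k\<in>UNIV. \<Sum>i\<in>UNIV. V j k x * Q i i j k x)"
      unfolding R_def by (simp add: Z[OF x, symmetric] sum_distrib_left)
    also have "\<dots> = (\<Sum>j\<in>UNIV. \<Sum>i\<in>UNIV. \<Sum>k\<in>UNIV. V j k x * Q i i j k x)"
      by (intro sum.cong refl sum.swap)
    also have "\<dots> = (\<Sum>i\<in>UNIV. \<Sum>j\<in>UNIV. \<Sum>k\<in>UNIV. V j k x * Q i i j k x)"
      by (rule sum.swap)
    finally have R: "R x = \<dots>" .
    show "(\<Sum>i\<in>UNIV. (W i x - 0) * (\<Sum>j\<in>UNIV. \<Sum>k\<in>UNIV. V j k x * T i j k x)
          + (w x - c) * (\<Sum>j\<in>UNIV. \<Sum>k\<in>UNIV. T i j k x * T i j k x + V j k x * Q i i j k x))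
      = A x + (w x - c) * T3 x + (w x - c) * R x"
      by (simp add: R A_def T3_def sum.distrib power2_eq_square distrib_left flip: sum_distrib_left)
  next
    fix i show "vanishing S (\<lambda>x. (w x - c) * (\<Sum>j\<in>UNIV. \<Sum>k\<in>UNIV. V j k x * T i j k x))"
      by (intro vanishing_mult[OF vw] ext)
  qed (intro hp ext)+
  \<comment> \<open>Removes A. The constant subtracted to make the field vanish on the boundary is
    the origin of the term c^2 g(u); H is left over.\<close>
  have I2: "((\<lambda>x. 2 * A x - (H x - c\<^sup>2) * \<gamma> x) has_integral 0) S"
  proof (rule div[where X="\<lambda>i x. ((\<Sum>j\<in>UNIV. \<Sum>k\<in>UNIV. (V j k x)\<^sup>2) - c\<^sup>2) * W i x" and
        X'="\<lambda>i x. ((\<Sum>j\<in>UNIV. \<Sum>k\<in>UNIV. 2 * (V j k x * T i j k x)) - 0) * W i x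
          + ((\<Sum>j\<in>UNIV. \<Sum>k\<in>UNIV. (V j k x)\<^sup>2) - c\<^sup>2) * Z i i x"])
    fix x assume x: "x \<in> S"
    show "(\<Sum>i\<in>UNIV. ((\<Sum>j\<in>UNIV. \<Sum>k\<in>UNIV. 2 * (V j k x * T i j k x)) - 0) * W i x
          + ((\<Sum>j\<in>UNIV. \<Sum>k\<in>UNIV. (V j k x)\<^sup>2) - c\<^sup>2) * Z i i x)
      = 2 * A x - (H x - c\<^sup>2) * \<gamma> x"
      by (simp add: H_def[symmetric] sum.distrib pde[OF x] flip: sum_distrib_left)
        (simp add: A_def sum_distrib_left mult_ac)
  next
    fix i show "vanishing S (\<lambda>x. ((\<Sum>j\<in>UNIV. \<Sum>k\<in>UNIV. (V j k x)\<^sup>2) - c\<^sup>2) * W i x)"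
      by (intro vanishing_mult[OF vV] ext)
  qed (intro hp ext)+
  \<comment> \<open>Removes R, because the divergence of D^2 u is grad w; leaves E.\<close>
  have I3: "((\<lambda>x. E x + (w x - c) * N x + (w x - c) * R x) has_integral 0) S"
  proof (rule div[where X="\<lambda>i x. (w x - c) * (\<Sum>j\<in>UNIV. V i j x * W j x)" and
        X'="\<lambda>i x. (W i x - 0) * (\<Sum>j\<in>UNIV. V i j x * W j x)
          + (w x - c) * (\<Sum>j\<in>UNIV. T i i j x * W j x + V i j x * Z i j x)"])
    fix x assume x: "x \<in> S"
    have "(\<Sum>i\<in>UNIV. \<Sum>j\<in>UNIV. T i i j x * W j x) = (\<Sum>j\<in>UNIV. \<Sum>i\<in>UNIV. T i i j x * W j x)"
      by (rule sum.swap)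
    also have "\<dots> = N x"
      by (simp add: N_def W[OF x] power2_eq_square flip: sum_distrib_right)
    finally show "(\<Sum>i\<in>UNIV. (W i x - 0) * (\<Sum>j\<in>UNIV. V i j x * W j x)
          + (w x - c) * (\<Sum>j\<in>UNIV. T i i j x * W j x + V i j x * Z i j x))
      = E x + (w x - c) * N x + (w x - c) * R x"
      by (simp add: E_def R_def sum.distrib distrib_left flip: sum_distrib_left)
  next
    fix i show "vanishing S (\<lambda>x. (w x - c) * (\<Sum>j\<in>UNIV. V i j x * W j x))"
      by (intro vanishing_mult[OF vw] ext)
  qed (intro hp ext)+
  \<comment> \<open>Trades (w - c) N for (w - c)^2 g(u), which settles the dependence on n.\<close>
  have I4: "((\<lambda>x. 2 * (w x - c) * N x - (w x - c)\<^sup>2 * \<gamma> x) has_integral 0) S"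
  proof (rule div[where X="\<lambda>i x. (w x - c) * ((w x - c) * W i x)" and
        X'="\<lambda>i x. (W i x - 0) * ((w x - c) * W i x) + (w x - c) * ((W i x - 0) * W i x + (w x - c) * Z i i x)"])
    fix x assume x: "x \<in> S"
    have "(W i x - 0) * ((w x - c) * W i x) + (w x - c) * ((W i x - 0) * W i x + (w x - c) * Z i i x)
      = 2 * (w x - c) * (W i x)\<^sup>2 + (w x - c)\<^sup>2 * Z i i x" for i
      by (simp add: power2_eq_square algebra_simps)
    then show "(\<Sum>i\<in>UNIV. (W i x - 0) * ((w x - c) * W i x) + (w x - c) * ((W i x - 0) * W i x + (w x - c) * Z i i x))
      = 2 * (w x - c) * N x - (w x - c)\<^sup>2 * \<gamma> x"
      by (simp add: N_def sum.distrib pde[OF x] flip: sum_distrib_left)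
  next
    fix i show "vanishing S (\<lambda>x. (w x - c) * ((w x - c) * W i x))"
      by (intro vanishing_mult[OF vw] ext)
  qed (intro hp ext)+
  \<comment> \<open>Removes E; leaves Y and P.\<close>
  have I5: "((\<lambda>x. E x + Y x - P x * \<gamma> x) has_integral 0) S"
  proof (rule div[where X="\<lambda>i x. (\<Sum>j\<in>UNIV. U j x * W j x) * W i x" and
        X'="\<lambda>i x. (\<Sum>j\<in>UNIV. V i j x * W j x + U j x * Z i j x) * W i x + (\<Sum>j\<in>UNIV. U j x * W j x) * Z i i x"])
    fix x assume x: "x \<in> S"
    have "Y x = (\<Sum>j\<in>UNIV. \<Sum>i\<in>UNIV. U i x * (Z i j x * W j x))"
      unfolding Y_def by (rule sum.swap)
    also have "\<dots> = (\<Sum>j\<in>UNIV. \<Sum>i\<in>UNIV. W j x * (U i x * Z j i x))"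
      by (simp add: symZ[OF x] mult_ac)
    finally have Y: "Y x = \<dots>" .
    show "(\<Sum>i\<in>UNIV. (\<Sum>j\<in>UNIV. V i j x * W j x + U j x * Z i j x) * W i x + (\<Sum>j\<in>UNIV. U j x * W j x) * Z i i x)
      = E x + Y x - P x * \<gamma> x"
      by (simp add: P_def[symmetric] sum.distrib pde[OF x] flip: sum_distrib_left)
        (simp add: E_def Y sum.distrib sum_distrib_left sum_distrib_right distrib_left distrib_right mult_ac)
  next
    fix i show "vanishing S (\<lambda>x. (\<Sum>j\<in>UNIV. U j x * W j x) * W i x)"
      by (intro vanishing_mult vanishing_sum vU ext)
  qed (intro hp ext)+
  \<comment> \<open>Removes Y; its w N joins the N terms of \<open>I3\<close>, \<open>I4\<close> and
    \<open>I8\<close>.\<close>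
  have I6: "((\<lambda>x. w x * N x + 2 * Y x) has_integral 0) S"
  proof (rule div[where X="\<lambda>i x. U i x * (\<Sum>j\<in>UNIV. (W j x)\<^sup>2)" and
        X'="\<lambda>i x. V i i x * (\<Sum>j\<in>UNIV. (W j x)\<^sup>2) + U i x * (\<Sum>j\<in>UNIV. 2 * (W j x * Z i j x))"])
    fix x assume x: "x \<in> S"
    show "(\<Sum>i\<in>UNIV. V i i x * (\<Sum>j\<in>UNIV. (W j x)\<^sup>2) + U i x * (\<Sum>j\<in>UNIV. 2 * (W j x * Z i j x)))
      = w x * N x + 2 * Y x"
      by (simp add: N_def[symmetric] sum.distrib w[OF x] flip: sum_distrib_right)
        (simp add: Y_def sum_distrib_left mult_ac)
  next
    fix i show "vanishing S (\<lambda>x. U i x * (\<Sum>j\<in>UNIV. (W j x)\<^sup>2))"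
      by (intro vanishing_mult vU ext)
  qed (intro hp ext)+
  \<comment> \<open>Trades P g(u) for G(u) g(u), since grad(G(u)) = g(u) grad u.\<close>
  have I7: "((\<lambda>x. P x * \<gamma> x - G x * \<gamma> x) has_integral 0) S"
  proof (rule div[where X="\<lambda>i x. G x * W i x" and X'="\<lambda>i x. \<gamma> x * U i x * W i x + G x * Z i i x"])
    fix x assume x: "x \<in> S"
    show "(\<Sum>i\<in>UNIV. \<gamma> x * U i x * W i x + G x * Z i i x) = P x * \<gamma> x - G x * \<gamma> x"
      by (simp add: sum.distrib pde[OF x] P_def mult.assoc mult.commute[of _ "\<gamma> x"] flip: sum_distrib_left)
  next
    fix i show "vanishing S (\<lambda>x. G x * W i x)"
      by (intro vanishing_mult[OF vG] ext)
  qed (intro hp ext)+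
  have I8: "((\<lambda>x. N x - (w x - c) * \<gamma> x) has_integral 0) S"
  proof (rule div[where X="\<lambda>i x. (w x - c) * W i x" and X'="\<lambda>i x. (W i x - 0) * W i x + (w x - c) * Z i i x"])
    fix x assume x: "x \<in> S"
    show "(\<Sum>i\<in>UNIV. (W i x - 0) * W i x + (w x - c) * Z i i x) = N x - (w x - c) * \<gamma> x"
      by (simp add: sum.distrib pde[OF x] N_def power2_eq_square flip: sum_distrib_left)
  next
    fix i show "vanishing S (\<lambda>x. (w x - c) * W i x)"
      by (intro vanishing_mult[OF vw] ext)
  qed (intro hp ext)+
  \<comment> \<open>Since grad(g(u)) = g1 grad u, this yields the term with the Laplacian of g(u),
    with B left over.\<close>
  have I9: "((\<lambda>x. 2 * B x * g1 x + K x * L x) has_integral 0) S"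
  proof (rule div[where X="\<lambda>i x. U i x * ((\<Sum>j\<in>UNIV. (U j x)\<^sup>2) * g1 x)" and
        X'="\<lambda>i x. V i i x * ((\<Sum>j\<in>UNIV. (U j x)\<^sup>2) * g1 x)
          + U i x * ((\<Sum>j\<in>UNIV. 2 * (U j x * V i j x)) * g1 x + (\<Sum>j\<in>UNIV. (U j x)\<^sup>2) * (g2 x * U i x))"])
    fix x assume x: "x \<in> S"
    have pw: "V i i x * (K x * g1 x) + U i x * ((\<Sum>j\<in>UNIV. 2 * (U j x * V i j x)) * g1 x + K x * (g2 x * U i x))
      = 2 * (\<Sum>j\<in>UNIV. U i x * (V i j x * U j x)) * g1 x + K x * (g2 x * U i x * U i x + g1 x * V i i x)" for i
      by (simp add: sum_distrib_left sum_distrib_right algebra_simps)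
    show "(\<Sum>i\<in>UNIV. V i i x * ((\<Sum>j\<in>UNIV. (U j x)\<^sup>2) * g1 x)
          + U i x * ((\<Sum>j\<in>UNIV. 2 * (U j x * V i j x)) * g1 x + (\<Sum>j\<in>UNIV. (U j x)\<^sup>2) * (g2 x * U i x)))
      = 2 * B x * g1 x + K x * L x"
      unfolding K_def[symmetric] pw B_def L_def
      by (subst sum.distrib) (simp only: sum_distrib_left sum_distrib_right)
  next
    fix i show "vanishing S (\<lambda>x. U i x * ((\<Sum>j\<in>UNIV. (U j x)\<^sup>2) * g1 x))"
      by (intro vanishing_mult vU ext)
  qed (intro hp ext)+
  \<comment> \<open>Removes both the H of \<open>I2\<close> and the B of \<open>I9\<close>, which
    ties the coefficient of the last term of the identity to the others.\<close>
  have I10: "((\<lambda>x. H x * \<gamma> x + P x * \<gamma> x + B x * g1 x) has_integral 0) S"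
  proof (rule div[where X="\<lambda>i x. (\<Sum>j\<in>UNIV. U j x * V i j x) * \<gamma> x" and
        X'="\<lambda>i x. (\<Sum>j\<in>UNIV. V i j x * V i j x + U j x * T i i j x) * \<gamma> x + (\<Sum>j\<in>UNIV. U j x * V i j x) * (g1 x * U i x)"])
    fix x assume x: "x \<in> S"
    have "(\<Sum>i\<in>UNIV. \<Sum>j\<in>UNIV. U j x * T i i j x) = (\<Sum>j\<in>UNIV. \<Sum>i\<in>UNIV. U j x * T i i j x)"
      by (rule sum.swap)
    also have "\<dots> = P x"
      by (simp add: P_def W[OF x] flip: sum_distrib_left)
    finally have P: "(\<Sum>i\<in>UNIV. \<Sum>j\<in>UNIV. U j x * T i i j x) = P x" .
    have B: "(\<Sum>i\<in>UNIV. (\<Sum>j\<in>UNIV. U j x * V i j x) * (g1 x * U i x)) = B x * g1 x"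
      by (simp add: B_def sum_distrib_left sum_distrib_right mult_ac)
    show "(\<Sum>i\<in>UNIV. (\<Sum>j\<in>UNIV. V i j x * V i j x + U j x * T i i j x) * \<gamma> x + (\<Sum>j\<in>UNIV. U j x * V i j x) * (g1 x * U i x))
      = H x * \<gamma> x + P x * \<gamma> x + B x * g1 x"
      by (simp add: sum.distrib B distrib_right P H_def power2_eq_square flip: sum_distrib_right)
  next
    fix i show "vanishing S (\<lambda>x. (\<Sum>j\<in>UNIV. U j x * V i j x) * \<gamma> x)"
      by (intro vanishing_mult vanishing_sum vU ext)
  qed (intro hp ext)+
  text \<open>The coefficients are chosen so that \<open>A\<close>, \<open>R\<close>, \<open>H\<close>, \<open>E\<close>, \<open>Y\<close>, \<open>P\<close> and \<open>B\<close> cancel.\<close>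
  let ?J = "\<lambda>x. (w x - c) * (T3 x - 3 / (n + 2) * N x)"
  let ?Z = "\<lambda>x. - (4 * (n + 2)) * (A x + (w x - c) * T3 x + (w x - c) * R x)
      + 2 * (n + 2) * (2 * A x - (H x - c\<^sup>2) * \<gamma> x)
      + 4 * (n + 2) * (E x + (w x - c) * N x + (w x - c) * R x)
      + (- 3 * n) * (2 * (w x - c) * N x - (w x - c)\<^sup>2 * \<gamma> x)
      + (- (4 * (n + 2))) * (E x + Y x - P x * \<gamma> x)
      + 2 * (n + 2) * (w x * N x + 2 * Y x)
      + (- (6 * (n + 2))) * (P x * \<gamma> x - G x * \<gamma> x)
      + (- (2 * (n + 2) * c)) * (N x - (w x - c) * \<gamma> x)
      + (- (n + 2)) * (2 * B x * g1 x + K x * L x)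
      + 2 * (n + 2) * (H x * \<gamma> x + P x * \<gamma> x + B x * g1 x)"
  have "(?Z has_integral (- (4 * (n + 2))) * 0 + 2 * (n + 2) * 0 + 4 * (n + 2) * 0 + (- 3 * n) * 0
      + (- (4 * (n + 2))) * 0 + 2 * (n + 2) * 0 + (- (6 * (n + 2))) * 0 + (- (2 * (n + 2) * c)) * 0
      + (- (n + 2)) * 0 + 2 * (n + 2) * 0) S"
    by (intro has_integral_add has_integral_mult_right I1 I2 I3 I4 I5 I6 I7 I8 I9 I10)
  then have Z0: "(?Z has_integral 0) S" by simp
  have eJ: "ext_cont S ?J" unfolding T3_def N_def by (intro ext)
  have eKL: "ext_cont S (\<lambda>x. K x * L x)" unfolding K_def L_def by (intro ext)
  have "((\<lambda>x. 4 * (n + 2) * ?J x + (n + 2) * (K x * L x) + ?Z x)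
      has_integral 4 * (n + 2) * integral S ?J + (n + 2) * integral S (\<lambda>x. K x * L x) + 0) S"
    using ext_cont_integrable_on[OF op bd eJ] ext_cont_integrable_on[OF op bd eKL]
    by (intro has_integral_add has_integral_mult_right Z0) (auto intro: integrable_integral)
  \<comment> \<open>Since (3n w - (n - 4)c)(w - c) = 3n (w - c)^2 + 2(n + 2)c (w - c), the
    coefficients of \<open>I4\<close> and \<open>I8\<close> are forced. The factor of (w - c) N is
    then 4(n + 2) - 6n + 2(n + 2) - 12 = 0.\<close>
  moreover have "4 * (n + 2) * ?J x + (n + 2) * (K x * L x) + ?Z x
    = (2 * (n + 2) * (3 * G x + c\<^sup>2) + (3 * n * w x - (n - 4) * c) * (w x - c)) * \<gamma> x" for x
  proof -
    have "(n + 2) * ?J x = (w x - c) * ((n + 2) * T3 x - 3 * N x)"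
      using n by (simp add: field_simps)
    then have "4 * (n + 2) * ?J x = 4 * ((w x - c) * ((n + 2) * T3 x - 3 * N x))"
      by (simp only: mult.assoc)
    then show ?thesis by (simp only:) (simp add: algebra_simps power2_eq_square)
  qed
  ultimately show ?thesis
    unfolding T3_def N_def K_def L_def by (simp add: integral_unique)
qed

section \<open>The primitive of g and limits at the boundary\<close>

lemma prim0_has_real_derivative:
  assumes "continuous_on UNIV g"
  shows "(prim0 g has_real_derivative g t) (at t)"
proof -
  \<comment> \<open>Puts 0 and t inside (-R, R), so that both branches of \<open>prim0\<close>
    become one integral from the fixed lower end -R minus a constant.\<close>
  define R where "R = \<bar>t\<bar> + 1"
  have co: "continuous_on A g" for A using assms continuous_on_subset by blast
  have int: "g integrable_on {a..b}" for a b by (rule integrable_continuous_real[OF co])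
  have eq: "integral {-R..s} g - integral {-R..0} g = prim0 g s" if "s \<in> {-R<..<R}" for s
  proof (cases "0 \<le> s")
    case True
    then have "integral {-R..0} g + integral {0..s} g = integral {-R..s} g"
      using that by (intro Henstock_Kurzweil_Integration.integral_combine int) (auto simp: R_def)
    then show ?thesis using True by (simp add: prim0_def)
  next
    case False
    then have "integral {-R..s} g + integral {s..0} g = integral {-R..0} g"
      using that by (intro Henstock_Kurzweil_Integration.integral_combine int) auto
    then show ?thesis using False by (simp add: prim0_def)
  qed
  have t: "t \<in> {-R<..<R}" by (auto simp: R_def)
  have "((\<lambda>s. integral {-R..s} g) has_real_derivative g t) (at t within {-R..R})"
    using t by (intro integral_has_real_derivative co) auto
  then have "((\<lambda>s. integral {-R..s} g) has_real_derivative g t) (at t)"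
    using t by (simp add: at_within_Icc_at)
  then have "((\<lambda>s. integral {-R..s} g - integral {-R..0} g) has_real_derivative g t) (at t)"
    by (auto intro!: derivative_eq_intros)
  moreover have "\<forall>\<^sub>F s in nhds t. s \<in> {-R<..<R}" using t by (intro eventually_nhds_in_open) auto
  then have "\<forall>\<^sub>F s in nhds t. integral {-R..s} g - integral {-R..0} g = prim0 g s"
    by eventually_elim (rule eq)
  ultimately show ?thesis using DERIV_cong_ev[OF refl _ refl] by iprover
qed

text \<open>Gives uniqueness of limits from inside, so that \<open>Lim\<close> in
  \<open>bval\<close> returns the limit whenever there is one.\<close>

lemma frontier_not_trivial_limit:
  assumes "open S" "p \<in> frontier S"
  shows "at p within S \<noteq> bot"
  using assms by (auto simp: trivial_limit_within frontier_def interior_open closure_def)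

lemma bval_eqI:
  assumes "open S" "p \<in> frontier S" "(f \<longlongrightarrow> l) (at p within S)"
  shows "bval S f p = l"
  unfolding bval_def using frontier_not_trivial_limit[OF assms(1,2)] assms(3) by (rule tendsto_Lim)

lemma ext_cont_tendsto_bval:
  assumes "open S" "p \<in> frontier S" "ext_cont S f"
  shows "(f \<longlongrightarrow> bval S f p) (at p within S)"
  using ext_cont_tendsto_ex[OF assms(3,2)] bval_eqI[OF assms(1,2)] by metis

text \<open>\<open>pd i f\<close> is known to agree with f' on S only; as S is open, this suffices
  to differentiate it again.\<close>

lemma hpart_pd_pd:
  assumes "open S" "hpart S i f f'" "hpart S i f' f''" "x \<in> S"
  shows "pd i (pd i f) x = f'' x"
proof -
  have "hpart S i (pd i f) f''"
    by (rule hpart_cong[OF assms(1) _ refl assms(3)]) (simp add: hpart_pd[OF assms(2)])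
  then show ?thesis using assms(4) by (rule hpart_pd)
qed

lemma norm_grad_squared: "(norm (grad f x))\<^sup>2 = (\<Sum>i\<in>UNIV. (pd i f x)\<^sup>2)"
  unfolding power2_norm_eq_inner inner_vec_def grad_def by (simp add: power2_eq_square)

section \<open>The identity applied to u\<close>

theorem theorem4:
  fixes \<Omega> :: "(real^'n) set" and u :: "real^'n \<Rightarrow> real"
    and g :: "real \<Rightarrow> real" and c :: real
  assumes n2: "CARD('n) \<ge> 2"
    and dom: "bounded_domain \<Omega>"
    and bdry: "\<exists>\<epsilon>. 0 < \<epsilon> \<and> \<epsilon> < 1 \<and> Ck_alpha_boundary 4 \<epsilon> \<Omega>"
    and gC2: "C2_real g"
    and uC4: "Ck_closure 4 u \<Omega>"
    and pde: "\<forall>x\<in>\<Omega>. lap (lap u) x = - g (u x)"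
    and bc0: "\<forall>p\<in>frontier \<Omega>. bval \<Omega> u p = 0"
    and bc1: "\<forall>p\<in>frontier \<Omega>. bval \<Omega> (grad u) p \<bullet> outward_normal \<Omega> p = 0"
    and bc2: "\<forall>p\<in>frontier \<Omega>. bval \<Omega> (lap u) p = c"
  shows "integral \<Omega> (\<lambda>x. (2 * (real CARD('n) + 2) * (3 * prim0 g (u x) + c\<^sup>2)
             + (3 * real CARD('n) * lap u x - (real CARD('n) - 4) * c) * (lap u x - c)) * g (u x))
       = 4 * (real CARD('n) + 2) * integral \<Omega> (\<lambda>x. (lap u x - c) *
             (hess3_sq u x - 3 / (real CARD('n) + 2) * (norm (grad (lap u) x))\<^sup>2))
         + (real CARD('n) + 2) * integral \<Omega> (\<lambda>x. (norm (grad u x))\<^sup>2 * lap (\<lambda>y. g (u y)) x)"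
proof -
  have op: "open \<Omega>" and bd: "bounded \<Omega>" using dom by (auto simp: bounded_domain_def)
  have Ck: "Ck_on 4 u \<Omega>" using uC4 by (simp add: Ck_closure_def)
  obtain \<alpha> where \<alpha>: "Ck_alpha_boundary 4 \<alpha> \<Omega>" using bdry by blast
  have hd: "hpart \<Omega> i (dpart js u) (dpart (i # js) u)" if "length js < 4" for i js
    by (rule Ck_on_hpart[OF Ck that])
  have ed: "ext_cont \<Omega> (dpart js u)" if "length js \<le> 4" for js
    using uC4 that unfolding Ck_closure_def ext_cont_def by blast
  have cd: "continuous_on \<Omega> (dpart js u)" if "length js \<le> 4" for js
    by (rule Ck_on_continuous_on[OF Ck that])
  \<comment> \<open>With at most two inner derivatives the mixed ones have order at most four, where
    continuity is still available.\<close>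
  have sym: "dpart (i # j # js) u x = dpart (j # i # js) u x" if "length js \<le> 2" "x \<in> \<Omega>" for i j js x
    by (rule schwarz_symmetry[OF op that(2), where f="dpart js u" and i=j and j=i])
      (use that(1) in \<open>auto intro!: hd cd simp del: dpart.simps\<close>)
  \<comment> \<open>Lets an equality be used under an outer derivative. The head of the list is the
    outermost one, so this is how \<open>sym\<close> reaches indices further inside.\<close>
  have cong: "dpart (i # js) u x = dpart (i # js') u x"
    if "\<And>x. x \<in> \<Omega> \<Longrightarrow> dpart js u x = dpart js' u x" "length js < 4" "x \<in> \<Omega>" for i js js' x
    using hpart_pd[OF hpart_cong[OF op that(1) refl hd[OF that(2)]] that(3)] by simp

  define U where "U i = dpart [i] u" for i
  define V where "V i j = dpart [i, j] u" for i j
  define T where "T i j k = dpart [i, j, k] u" for i j k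
  define Q where "Q i j k l = dpart [i, j, k, l] u" for i j k l
  define W where "W i x = (\<Sum>j\<in>UNIV. T i j j x)" for i x
  define Z where "Z i j x = (\<Sum>k\<in>UNIV. Q i j k k x)" for i j x
  define g1 where "g1 x = deriv g (u x)" for x
  define g2 where "g2 x = deriv (deriv g) (u x)" for x
  note [simp del] = dpart.simps(2)
  have lap: "lap u x = (\<Sum>i\<in>UNIV. V i i x)" for x
    by (simp add: lap_def V_def dpart.simps(2))
  have hu: "hpart \<Omega> i u (U i)" and hU: "hpart \<Omega> i (U j) (V i j)"
    and hV: "hpart \<Omega> i (V j k) (T i j k)" and hT: "hpart \<Omega> i (T j k l) (Q i j k l)" for i j k l
    using hd[of "[]"] hd[of "[j]"] hd[of "[j, k]"] hd[of "[j, k, l]"] by (simp_all add: U_def V_def T_def Q_def)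
  have hw: "hpart \<Omega> i (lap u) (W i)" and hW: "hpart \<Omega> i (W j) (Z i j)" for i j
    unfolding lap[abs_def] W_def[abs_def] Z_def[abs_def] by (intro hpart_sum hV hT)+
  have eu: "ext_cont \<Omega> u" and eU: "ext_cont \<Omega> (U i)" and eV: "ext_cont \<Omega> (V i j)"
    and eT: "ext_cont \<Omega> (T i j k)" and eQ: "ext_cont \<Omega> (Q i j k l)" for i j k l
    using ed[of "[]"] ed[of "[i]"] ed[of "[i, j]"] ed[of "[i, j, k]"] ed[of "[i, j, k, l]"]
    by (simp_all add: U_def V_def T_def Q_def)
  have ew: "ext_cont \<Omega> (lap u)" and eW: "ext_cont \<Omega> (W i)" and eZ: "ext_cont \<Omega> (Z i j)" for i j
    unfolding lap[abs_def] W_def[abs_def] Z_def[abs_def] by (intro ext_cont_sum eV eT eQ)+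
  have dg: "(g has_real_derivative deriv g t) (at t)"
    and dg': "(deriv g has_real_derivative deriv (deriv g) t) (at t)" for t
    using gC2 by (auto simp: C2_real_def differentiable_on_def DERIV_deriv_iff_real_differentiable)
  have cg: "continuous_on UNIV g" "continuous_on UNIV (deriv g)" "continuous_on UNIV (deriv (deriv g))"
    using gC2 by (auto simp: C2_real_def differentiable_imp_continuous_on)
  have dG: "(prim0 g has_real_derivative g t) (at t)" for t
    by (rule prim0_has_real_derivative[OF cg(1)])
  have cG: "continuous_on UNIV (prim0 g)"
    using dG by (meson DERIV_isCont continuous_at_imp_continuous_on)
  have h0: "hpart \<Omega> i (\<lambda>x. g (u x)) (\<lambda>x. g1 x * U i x)" and h1: "hpart \<Omega> i g1 (\<lambda>x. g2 x * U i x)"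
    and hG: "hpart \<Omega> i (\<lambda>x. prim0 g (u x)) (\<lambda>x. g (u x) * U i x)" for i
    unfolding g1_def[abs_def] g2_def[abs_def] 
    by (rule hpart_compose[OF hu dg] hpart_compose[OF hu dg'] hpart_compose[OF hu dG])+
  have e\<gamma>: "ext_cont \<Omega> (\<lambda>x. g (u x))" and e1: "ext_cont \<Omega> g1" and e2: "ext_cont \<Omega> g2"
    and eG: "ext_cont \<Omega> (\<lambda>x. prim0 g (u x))"
    unfolding g1_def[abs_def] g2_def[abs_def] 
    by (rule ext_cont_compose[OF eu cg(1)] ext_cont_compose[OF eu cg(2)]
        ext_cont_compose[OF eu cg(3)] ext_cont_compose[OF eu cG])+

  have symV: "V i j x = V j i x" if "x \<in> \<Omega>" for i j x
    using sym[of "[]" x] that by (simp add: V_def)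
  \<comment> \<open>Differentiating the Laplacian gives T j i i, while the divergence of the Hessian
    gives T i i j. The equality after this one is its analogue one order higher.\<close>
  have T_rot: "T i i j x = T j i i x" if "x \<in> \<Omega>" for i j x
  proof -
    have "T i i j x = dpart [i, j, i] u x"
      unfolding T_def by (rule cong[OF sym _ that]) auto
    also have "\<dots> = T j i i x"
      unfolding T_def by (rule sym) (use that in auto)
    finally show ?thesis .
  qed
  have Q_rot: "Q i i j k x = Q j k i i x" if "x \<in> \<Omega>" for i j k x
  proof -
    have "Q i i j k x = dpart [i, j, i, k] u x"
      unfolding Q_def by (rule cong[OF sym _ that]) auto
    also have "\<dots> = dpart [j, i, i, k] u x" by (rule sym) (use that in auto)
    also have "\<dots> = Q j k i i x"
      unfolding Q_def by (rule cong[OF _ _ that]) (use T_rot in \<open>auto simp: T_def\<close>)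
    finally show ?thesis .
  qed
  have symZ: "Z i j x = Z j i x" if "x \<in> \<Omega>" for i j x
    unfolding Z_def Q_def by (intro sum.cong refl sym that) auto
  have lap2: "lap (lap u) x = (\<Sum>i\<in>UNIV. Z i i x)" if "x \<in> \<Omega>" for x
    unfolding lap_def[of "lap u"] by (intro sum.cong refl hpart_pd_pd[OF op hw hW that])
  have lapg: "lap (\<lambda>y. g (u y)) x = (\<Sum>i\<in>UNIV. g2 x * U i x * U i x + g1 x * V i i x)" if "x \<in> \<Omega>" for x
    unfolding lap_def by (intro sum.cong refl hpart_pd_pd[OF op h0 hpart_mult[OF h1 hU] that])
  have gradu: "(norm (grad u x))\<^sup>2 = (\<Sum>i\<in>UNIV. (U i x)\<^sup>2)" for x
    by (simp add: norm_grad_squared U_def dpart.simps(2))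
  have gradw: "(norm (grad (lap u) x))\<^sup>2 = (\<Sum>i\<in>UNIV. (W i x)\<^sup>2)" if "x \<in> \<Omega>" for x
    by (simp add: norm_grad_squared hpart_pd[OF hw that])

  have tends: "(f \<longlongrightarrow> bval \<Omega> f p) (at p within \<Omega>)" if "p \<in> frontier \<Omega>" "ext_cont \<Omega> f" for f p
    by (rule ext_cont_tendsto_bval[OF op that])
  have vu: "vanishing \<Omega> u"
    unfolding vanishing_def using tends[OF _ eu] bc0 by simp
  have vw: "vanishing \<Omega> (\<lambda>x. lap u x - c)"
    unfolding vanishing_def using tends[OF _ ew] bc2 by (simp add: LIM_zero)
  have vG: "vanishing \<Omega> (\<lambda>x. prim0 g (u x))"
    unfolding vanishing_def
  proof
    fix p assume "p \<in> frontier \<Omega>"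
    then have "(u \<longlongrightarrow> 0) (at p within \<Omega>)" using vu by (simp add: vanishing_def)
    moreover have "(prim0 g \<longlongrightarrow> prim0 g 0) (nhds 0)"
      using DERIV_isCont[OF dG] by (simp add: isCont_def tendsto_at_iff_tendsto_nhds)
    moreover have "prim0 g 0 = 0" by (simp add: prim0_def)
    ultimately show "((\<lambda>x. prim0 g (u x)) \<longlongrightarrow> 0) (at p within \<Omega>)"
      using filterlim_compose by fastforce
  qed
  have vU: "vanishing \<Omega> (U i)" for i
    unfolding vanishing_def
  proof
    fix p assume p: "p \<in> frontier \<Omega>"
    define l where "l = (\<chi> i. bval \<Omega> (U i) p)"
    have lim: "(U i \<longlongrightarrow> l $ i) (at p within \<Omega>)" for i
      using tends[OF p eU] by (simp add: l_def)
    then have "(grad u \<longlongrightarrow> l) (at p within \<Omega>)"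
      by (intro vec_tendstoI) (simp add: grad_def U_def dpart.simps(2))
    then have "l \<bullet> outward_normal \<Omega> p = 0" using bc1 p bval_eqI[OF op p] by metis
    \<comment> \<open>The limit gradient is parallel to the normal, and the Neumann condition makes
      its normal component 0.\<close>
    then have "l = 0"
      using boundary_gradient_normal(2)[OF op bd hu eu eU vu \<alpha> _ p lim] by simp
    then show "(U i \<longlongrightarrow> 0) (at p within \<Omega>)" using lim[of i] by simp
  qed
  have vV: "vanishing \<Omega> (\<lambda>x. (\<Sum>i\<in>UNIV. \<Sum>j\<in>UNIV. (V i j x)\<^sup>2) - c\<^sup>2)"
    unfolding vanishing_def
  proof
    fix p assume p: "p \<in> frontier \<Omega>"
    define L where "L i j = bval \<Omega> (V i j) p" for i j
    define \<nu> where "\<nu> = outward_normal \<Omega> p"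
    \<comment> \<open>Each first derivative of u vanishes on the boundary, so column j of the
      limiting Hessian is its normal component \<open>a j\<close> times nu.\<close>
    define a where "a j = (\<chi> i. L i j) \<bullet> \<nu>" for j
    define \<beta> where "\<beta> = (\<Sum>i\<in>UNIV. a i * \<nu> $ i)"
    have lim: "(V i j \<longlongrightarrow> L i j) (at p within \<Omega>)" for i j
      unfolding L_def by (rule tends[OF p eV])
    have nrm: "norm \<nu> = 1" and "(\<chi> i. L i j) = a j *\<^sub>R \<nu>" for j
      using boundary_gradient_normal[OF op bd hU[of _ j] eU eV vU \<alpha> _ p, where l = "\<chi> i. L i j"] lim
      by (simp_all add: \<nu>_def a_def)
    then have La: "L i j = a j * \<nu> $ i" for i j
      by (metis vec_lambda_beta vector_scaleR_component real_scaleR_def)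
    have nn: "(\<Sum>i\<in>UNIV. (\<nu> $ i)\<^sup>2) = 1"
      using nrm by (simp add: norm_vec_def L2_set_def)
    have symL: "L i j = L j i" for i j
    proof (rule tendsto_unique[OF frontier_not_trivial_limit[OF op p] lim])
      show "(V i j \<longlongrightarrow> L j i) (at p within \<Omega>)"
        by (rule Lim_transform_eventually[OF lim[of j i]]) (auto simp: eventually_at_filter symV)
    qed
    \<comment> \<open>Symmetry at work: a j = sum_i L i j nu_i = sum_i L j i nu_i = (sum_i a i nu_i)
      nu_j.\<close>
    have a: "a j = \<beta> * \<nu> $ j" for j
    proof -
      have "a j = (\<Sum>i\<in>UNIV. a j * \<nu> $ i * \<nu> $ i)"
        using nn by (simp add: mult.assoc power2_eq_square flip: sum_distrib_left)
      also have "\<dots> = (\<Sum>i\<in>UNIV. a i * \<nu> $ i * \<nu> $ j)"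
        using symL[of _ j] by (intro sum.cong) (auto simp: La mult_ac)
      finally show ?thesis by (simp add: \<beta>_def sum_distrib_right)
    qed
    have L: "L i j = \<beta> * \<nu> $ i * \<nu> $ j" for i j by (simp add: La a)
    have "(lap u \<longlongrightarrow> (\<Sum>i\<in>UNIV. L i i)) (at p within \<Omega>)"
      unfolding lap[abs_def] by (intro tendsto_sum lim)
    moreover have "(\<Sum>i\<in>UNIV. L i i) = \<beta>"
      using nn by (simp add: L mult.assoc power2_eq_square flip: sum_distrib_left)
    ultimately have \<beta>: "\<beta> = c" using bval_eqI[OF op p] bc2 p by metis
    have "(\<Sum>i\<in>UNIV. \<Sum>j\<in>UNIV. (L i j)\<^sup>2) = c\<^sup>2"
      using nn by (simp add: L \<beta> power_mult_distrib flip: sum_distrib_left sum_distrib_right)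
    moreover have "((\<lambda>x. (\<Sum>i\<in>UNIV. \<Sum>j\<in>UNIV. (V i j x)\<^sup>2) - c\<^sup>2) \<longlongrightarrow> (\<Sum>i\<in>UNIV. \<Sum>j\<in>UNIV. (L i j)\<^sup>2) - c\<^sup>2) (at p within \<Omega>)"
      by (intro tendsto_intros lim)
    ultimately show "((\<lambda>x. (\<Sum>i\<in>UNIV. \<Sum>j\<in>UNIV. (V i j x)\<^sup>2) - c\<^sup>2) \<longlongrightarrow> 0) (at p within \<Omega>)"
      by simp
  qed

  have "integral \<Omega> (\<lambda>x. (2 * (real CARD('n) + 2) * (3 * prim0 g (u x) + c\<^sup>2)
             + (3 * real CARD('n) * lap u x - (real CARD('n) - 4) * c) * (lap u x - c)) * g (u x))
       = 4 * (real CARD('n) + 2) * integral \<Omega> (\<lambda>x. (lap u x - c) *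
             ((\<Sum>i\<in>UNIV. \<Sum>j\<in>UNIV. \<Sum>k\<in>UNIV. (T i j k x)\<^sup>2)
               - 3 / (real CARD('n) + 2) * (\<Sum>i\<in>UNIV. (W i x)\<^sup>2)))
         + (real CARD('n) + 2) * integral \<Omega> (\<lambda>x. (\<Sum>i\<in>UNIV. (U i x)\<^sup>2) *
             (\<Sum>i\<in>UNIV. g2 x * U i x * U i x + g1 x * V i i x))"
  proof (rule overdetermined_biharmonic_identity[OF op bd hU hV hT hw hW h0 h1 hG
        eU eV eT eQ ew eW eZ e\<gamma> e1 e2 eG symZ _ _ _ _ vU vG vw vV])
    fix x j k assume x: "x \<in> \<Omega>"
    show "(\<Sum>i\<in>UNIV. V i i x) = lap u x" by (simp add: lap)
    show "(\<Sum>i\<in>UNIV. T i i j x) = W j x" unfolding W_def by (intro sum.cong refl T_rot x)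
    show "(\<Sum>i\<in>UNIV. Q i i j k x) = Z j k x" unfolding Z_def by (intro sum.cong refl Q_rot x)
    show "(\<Sum>i\<in>UNIV. Z i i x) = - g (u x)" using pde x by (simp add: lap2)
  qed simp_all
  also have "integral \<Omega> (\<lambda>x. (lap u x - c) * ((\<Sum>i\<in>UNIV. \<Sum>j\<in>UNIV. \<Sum>k\<in>UNIV. (T i j k x)\<^sup>2)
      - 3 / (real CARD('n) + 2) * (\<Sum>i\<in>UNIV. (W i x)\<^sup>2)))
    = integral \<Omega> (\<lambda>x. (lap u x - c) * (hess3_sq u x - 3 / (real CARD('n) + 2) * (norm (grad (lap u) x))\<^sup>2))"
    by (rule integral_cong) (simp add: gradw hess3_sq_def T_def)
  also have "integral \<Omega> (\<lambda>x. (\<Sum>i\<in>UNIV. (U i x)\<^sup>2) * (\<Sum>i\<in>UNIV. g2 x * U i x * U i x + g1 x * V i i x))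
    = integral \<Omega> (\<lambda>x. (norm (grad u x))\<^sup>2 * lap (\<lambda>y. g (u y)) x)"
    by (rule integral_cong) (simp add: gradu lapg)
  finally show ?thesis .
qed

end
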